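(* Let $R$ be a ring, $G$ a group and $RG$ the group ring of $G$ over $R$. (1) If $RG$ is a $W\Delta U$ ring, then $R$ is also a $W\Delta U$ ring. (2) If $R$ is a $W\Delta U$ ring and $G$ is a locally finite $p$-group, where $p$ is a prime number such that $p\in J(R)$, then $RG$ is a $W\Delta U$ ring.
   Context: Rings are associative with identity, not necessarily commutative. $J(R)$ is the Jacobson radical of $R$. A $p$-group is a group in which every element has order a power of the prime $p$; a group is locally finite if every finitely generated subgroup is finite. $U(S)$ is the group of units of a ring $S$. $\Delta(S)=\{r\in S : r+u\in U(S)\text{ for all }u\in U(S)\}$; equivalently $\Delta(S)=J(T)$, where $T$ is the subring of $S$ generated by $U(S)$. $S$ is $W\Delta U$ if $U(S)=\pm 1+\Delta(S)$, i.e. every unit of $S$ has the form $1+d$ or $-1+d$ with $d\in\Delta(S)$. *)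

theory Defs
  imports "HOL-Algebra.Algebra"
begin

section \<open>Group rings\<close>

text \<open>
  Elements of \<open>RG\<close> are the finitely supported functions from \<open>carrier G\<close> to \<open>carrier R\<close>, that is,
  the formal sums of the \<open>f g\<close> times \<open>g\<close>. They are made total by the value zero outside
  \<open>carrier G\<close>, so that equality of such functions is equality in \<open>RG\<close>. In the convolution product
  the pairs \<open>(y, z)\<close> with \<open>y z = x\<close> are parametrised by \<open>y\<close>, and \<open>y\<close> ranges over the
  finite support of the first factor because \<open>finsum\<close> is meaningful for finite index sets only.
\<close>

definition group_ring ::
    "('r, 'm) ring_scheme \<Rightarrow> ('g, 'n) monoid_scheme \<Rightarrow> ('g \<Rightarrow> 'r) ring"
  where "group_ring R G =
    \<lparr> carrier = {f. (\<forall>x \<in> carrier G. f x \<in> carrier R) \<and> (\<forall>x. x \<notin> carrier G \<longrightarrow> f x = \<zero>\<^bsub>R\<^esub>) \<and>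
                   finite {x. f x \<noteq> \<zero>\<^bsub>R\<^esub>}},
      monoid.mult = (\<lambda>f h x. if x \<in> carrier G
                      then \<Oplus>\<^bsub>R\<^esub>y \<in> {y. f y \<noteq> \<zero>\<^bsub>R\<^esub>}. f y \<otimes>\<^bsub>R\<^esub> h (inv\<^bsub>G\<^esub> y \<otimes>\<^bsub>G\<^esub> x)
                      else \<zero>\<^bsub>R\<^esub>),
      monoid.one = (\<lambda>x. if x = \<one>\<^bsub>G\<^esub> then \<one>\<^bsub>R\<^esub> else \<zero>\<^bsub>R\<^esub>),
      ring.zero = (\<lambda>x. \<zero>\<^bsub>R\<^esub>),
      ring.add = (\<lambda>f h x. f x \<oplus>\<^bsub>R\<^esub> h x) \<rparr>"

lemma (in ring) finsum_swap:
  assumes "finite A" "finite B" "\<And>x y. x \<in> A \<Longrightarrow> y \<in> B \<Longrightarrow> t x y \<in> carrier R"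
  shows "(\<Oplus>x\<in>A. \<Oplus>y\<in>B. t x y) = (\<Oplus>y\<in>B. \<Oplus>x\<in>A. t x y)"
  using assms(1,3)
proof (induction A rule: finite_induct)
  case empty
  show ?case by (simp add: finsum_zero)
next
  case (insert a A)
  have *: "(\<Oplus>x\<in>insert a A. t x y) = t a y \<oplus> (\<Oplus>x\<in>A. t x y)" if "y \<in> B" for y
    using insert that by (intro finsum_insert) auto
  have "(\<Oplus>x\<in>insert a A. \<Oplus>y\<in>B. t x y) = (\<Oplus>y\<in>B. t a y) \<oplus> (\<Oplus>x\<in>A. \<Oplus>y\<in>B. t x y)"
    using insert by (intro finsum_insert) (auto intro!: finsum_closed)
  also have "\<dots> = (\<Oplus>y\<in>B. t a y) \<oplus> (\<Oplus>y\<in>B. \<Oplus>x\<in>A. t x y)"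
    using insert by simp
  also have "\<dots> = (\<Oplus>y\<in>B. t a y \<oplus> (\<Oplus>x\<in>A. t x y))"
    using insert by (intro finsum_addf[symmetric]) (auto intro!: finsum_closed)
  also have "\<dots> = (\<Oplus>y\<in>B. \<Oplus>x\<in>insert a A. t x y)"
    using insert.prems insert.hyps
    by (intro finsum_cong') (auto simp: * intro!: a_closed finsum_closed)
  finally show ?case .
qed

lemma ring_group_ring:
  assumes "ring R" "group G"
  shows "ring (group_ring R G)"
proof -
  interpret R: ring R by fact
  interpret G: group G by fact
  let ?S = "group_ring R G"
  define supp where "supp f = {x. f x \<noteq> \<zero>\<^bsub>R\<^esub>}" for f :: "'c \<Rightarrow> 'a"
  have car: "f \<in> carrier ?S \<longleftrightarrow> (\<forall>x \<in> carrier G. f x \<in> carrier R) \<and>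
      (\<forall>x. x \<notin> carrier G \<longrightarrow> f x = \<zero>\<^bsub>R\<^esub>) \<and> finite (supp f)" for f
    by (simp add: group_ring_def supp_def)
  have val: "f x \<in> carrier R" if "f \<in> carrier ?S" for f x
    using that by (cases "x \<in> carrier G") (auto simp: car)
  have fin: "finite (supp f)" if "f \<in> carrier ?S" for f
    using that by (simp add: car)
  have sub: "supp f \<subseteq> carrier G" if "f \<in> carrier ?S" for f
    using that by (auto simp: car supp_def)
  have add: "(f \<oplus>\<^bsub>?S\<^esub> h) = (\<lambda>x. f x \<oplus>\<^bsub>R\<^esub> h x)" for f h
    by (simp add: group_ring_def)
  have zero: "\<zero>\<^bsub>?S\<^esub> = (\<lambda>x. \<zero>\<^bsub>R\<^esub>)"
    by (simp add: group_ring_def)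
  have one: "\<one>\<^bsub>?S\<^esub> = (\<lambda>x. if x = \<one>\<^bsub>G\<^esub> then \<one>\<^bsub>R\<^esub> else \<zero>\<^bsub>R\<^esub>)"
    by (simp add: group_ring_def)
  have mult0: "(f \<otimes>\<^bsub>?S\<^esub> h) x = \<zero>\<^bsub>R\<^esub>" if "x \<notin> carrier G" for f h x
    using that by (simp add: group_ring_def)
  have mult: "(f \<otimes>\<^bsub>?S\<^esub> h) x = (\<Oplus>\<^bsub>R\<^esub>y \<in> A. f y \<otimes>\<^bsub>R\<^esub> h (inv\<^bsub>G\<^esub> y \<otimes>\<^bsub>G\<^esub> x))"
    if "x \<in> carrier G" "f \<in> carrier ?S" "h \<in> carrier ?S" "finite A" "supp f \<subseteq> A" for f h x A
  proof -
    have "(f \<otimes>\<^bsub>?S\<^esub> h) x = (\<Oplus>\<^bsub>R\<^esub>y \<in> supp f. f y \<otimes>\<^bsub>R\<^esub> h (inv\<^bsub>G\<^esub> y \<otimes>\<^bsub>G\<^esub> x))"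
      using that(1) by (simp add: group_ring_def supp_def)
    also have "\<dots> = (\<Oplus>\<^bsub>R\<^esub>y \<in> A. f y \<otimes>\<^bsub>R\<^esub> h (inv\<^bsub>G\<^esub> y \<otimes>\<^bsub>G\<^esub> x))"
      by (rule R.add.finprod_mono_neutral_cong_left) (use that val in \<open>auto simp: supp_def\<close>)
    finally show ?thesis .
  qed
  have closed: "f \<otimes>\<^bsub>?S\<^esub> h \<in> carrier ?S"
    and supp_mult: "supp (f \<otimes>\<^bsub>?S\<^esub> h) \<subseteq> (\<lambda>(y, z). y \<otimes>\<^bsub>G\<^esub> z) ` (supp f \<times> supp h)"
    if f: "f \<in> carrier ?S" and h: "h \<in> carrier ?S" for f h
  proof -
    show *: "supp (f \<otimes>\<^bsub>?S\<^esub> h) \<subseteq> (\<lambda>(y, z). y \<otimes>\<^bsub>G\<^esub> z) ` (supp f \<times> supp h)"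
    proof
      fix x assume x: "x \<in> supp (f \<otimes>\<^bsub>?S\<^esub> h)"
      hence xG: "x \<in> carrier G" using mult0 by (auto simp: supp_def)
      have "\<exists>y \<in> supp f. h (inv\<^bsub>G\<^esub> y \<otimes>\<^bsub>G\<^esub> x) \<noteq> \<zero>\<^bsub>R\<^esub>"
      proof (rule ccontr)
        assume "\<not> ?thesis"
        hence "(\<Oplus>\<^bsub>R\<^esub>y \<in> supp f. f y \<otimes>\<^bsub>R\<^esub> h (inv\<^bsub>G\<^esub> y \<otimes>\<^bsub>G\<^esub> x)) = (\<Oplus>\<^bsub>R\<^esub>y \<in> supp f. \<zero>\<^bsub>R\<^esub>)"
          using val f by (intro R.finsum_cong') auto
        with x mult[OF xG f h fin[OF f] order_refl] show False
          by (simp add: supp_def R.finsum_zero)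
      qed
      then obtain y where y: "y \<in> supp f" "h (inv\<^bsub>G\<^esub> y \<otimes>\<^bsub>G\<^esub> x) \<noteq> \<zero>\<^bsub>R\<^esub>" by blast
      moreover have "x = y \<otimes>\<^bsub>G\<^esub> (inv\<^bsub>G\<^esub> y \<otimes>\<^bsub>G\<^esub> x)"
        using y(1) sub[OF f] xG by (auto simp: G.m_assoc[symmetric])
      ultimately show "x \<in> (\<lambda>(y, z). y \<otimes>\<^bsub>G\<^esub> z) ` (supp f \<times> supp h)"
        by (force simp: supp_def)
    qed
    have "finite (supp (f \<otimes>\<^bsub>?S\<^esub> h))"
      by (rule finite_subset[OF *]) (use fin f h in auto)
    moreover have "(f \<otimes>\<^bsub>?S\<^esub> h) x \<in> carrier R" if "x \<in> carrier G" for x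
      using that f h val by (auto simp: mult[OF that f h fin[OF f] order_refl] intro!: R.finsum_closed)
    ultimately show "f \<otimes>\<^bsub>?S\<^esub> h \<in> carrier ?S"
      using mult0 by (auto simp: car)
  qed
  have assoc: "(f \<otimes>\<^bsub>?S\<^esub> h) \<otimes>\<^bsub>?S\<^esub> k = f \<otimes>\<^bsub>?S\<^esub> (h \<otimes>\<^bsub>?S\<^esub> k)"
    if f: "f \<in> carrier ?S" and h: "h \<in> carrier ?S" and k: "k \<in> carrier ?S" for f h k
  proof
    fix x
    show "((f \<otimes>\<^bsub>?S\<^esub> h) \<otimes>\<^bsub>?S\<^esub> k) x = (f \<otimes>\<^bsub>?S\<^esub> (h \<otimes>\<^bsub>?S\<^esub> k)) x"
    proof (cases "x \<in> carrier G")
      case x: True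
      define W where "W = (\<lambda>(y, z). y \<otimes>\<^bsub>G\<^esub> z) ` (supp f \<times> supp h)"
      have W: "finite W" "W \<subseteq> carrier G"
        using fin sub f h by (auto simp: W_def)
      have inner: "(\<Oplus>\<^bsub>R\<^esub>w \<in> W. f y \<otimes>\<^bsub>R\<^esub> h (inv\<^bsub>G\<^esub> y \<otimes>\<^bsub>G\<^esub> w) \<otimes>\<^bsub>R\<^esub> k (inv\<^bsub>G\<^esub> w \<otimes>\<^bsub>G\<^esub> x))
          = f y \<otimes>\<^bsub>R\<^esub> (h \<otimes>\<^bsub>?S\<^esub> k) (inv\<^bsub>G\<^esub> y \<otimes>\<^bsub>G\<^esub> x)" (is "?l = ?r") if y: "y \<in> supp f" for y
      proof -
        have yG: "y \<in> carrier G" using y sub f by auto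
        have inj: "inj_on (\<lambda>z. y \<otimes>\<^bsub>G\<^esub> z) (supp h)"
          using sub[OF h] yG by (meson G.l_cancel inj_onI subsetD)
        have canc: "inv\<^bsub>G\<^esub> y \<otimes>\<^bsub>G\<^esub> (y \<otimes>\<^bsub>G\<^esub> z) = z" if "z \<in> carrier G" for z
          using yG that by (simp add: G.m_assoc[symmetric])
        have canc': "y \<otimes>\<^bsub>G\<^esub> (inv\<^bsub>G\<^esub> y \<otimes>\<^bsub>G\<^esub> z) = z" if "z \<in> carrier G" for z
          using yG that by (simp add: G.m_assoc[symmetric])
        have "?l = (\<Oplus>\<^bsub>R\<^esub>w \<in> (\<lambda>z. y \<otimes>\<^bsub>G\<^esub> z) ` supp h.
            f y \<otimes>\<^bsub>R\<^esub> h (inv\<^bsub>G\<^esub> y \<otimes>\<^bsub>G\<^esub> w) \<otimes>\<^bsub>R\<^esub> k (inv\<^bsub>G\<^esub> w \<otimes>\<^bsub>G\<^esub> x))"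
        proof (rule R.add.finprod_mono_neutral_cong_right)
          show "(\<lambda>z. y \<otimes>\<^bsub>G\<^esub> z) ` supp h \<subseteq> W" using y by (auto simp: W_def)
          fix w assume "w \<in> W - (\<lambda>z. y \<otimes>\<^bsub>G\<^esub> z) ` supp h"
          hence w: "w \<in> carrier G" "w \<notin> (\<lambda>z. y \<otimes>\<^bsub>G\<^esub> z) ` supp h" using W by auto
          have "inv\<^bsub>G\<^esub> y \<otimes>\<^bsub>G\<^esub> w \<notin> supp h"
            using w canc'[OF w(1)] by (metis imageI)
          thus "f y \<otimes>\<^bsub>R\<^esub> h (inv\<^bsub>G\<^esub> y \<otimes>\<^bsub>G\<^esub> w) \<otimes>\<^bsub>R\<^esub> k (inv\<^bsub>G\<^esub> w \<otimes>\<^bsub>G\<^esub> x) = \<zero>\<^bsub>R\<^esub>"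
            using val f k by (simp add: supp_def)
        qed (use W val f h k in auto)
        also have "\<dots> = (\<Oplus>\<^bsub>R\<^esub>z \<in> supp h. f y \<otimes>\<^bsub>R\<^esub> h (inv\<^bsub>G\<^esub> y \<otimes>\<^bsub>G\<^esub> (y \<otimes>\<^bsub>G\<^esub> z)) \<otimes>\<^bsub>R\<^esub>
            k (inv\<^bsub>G\<^esub> (y \<otimes>\<^bsub>G\<^esub> z) \<otimes>\<^bsub>G\<^esub> x))"
          by (rule R.finsum_reindex) (use val f h k inj in auto)
        also have "\<dots> = (\<Oplus>\<^bsub>R\<^esub>z \<in> supp h. f y \<otimes>\<^bsub>R\<^esub> (h z \<otimes>\<^bsub>R\<^esub>
            k (inv\<^bsub>G\<^esub> z \<otimes>\<^bsub>G\<^esub> (inv\<^bsub>G\<^esub> y \<otimes>\<^bsub>G\<^esub> x))))"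
        proof (rule R.finsum_cong')
          fix z assume "z \<in> supp h"
          hence z: "z \<in> carrier G" using sub h by auto
          show "f y \<otimes>\<^bsub>R\<^esub> h (inv\<^bsub>G\<^esub> y \<otimes>\<^bsub>G\<^esub> (y \<otimes>\<^bsub>G\<^esub> z)) \<otimes>\<^bsub>R\<^esub> k (inv\<^bsub>G\<^esub> (y \<otimes>\<^bsub>G\<^esub> z) \<otimes>\<^bsub>G\<^esub> x)
            = f y \<otimes>\<^bsub>R\<^esub> (h z \<otimes>\<^bsub>R\<^esub> k (inv\<^bsub>G\<^esub> z \<otimes>\<^bsub>G\<^esub> (inv\<^bsub>G\<^esub> y \<otimes>\<^bsub>G\<^esub> x)))"
            using z yG x val f h k
            by (simp add: canc G.inv_mult_group G.m_assoc R.m_assoc)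
        qed (use val f h k in auto)
        also have "\<dots> = f y \<otimes>\<^bsub>R\<^esub> (\<Oplus>\<^bsub>R\<^esub>z \<in> supp h. h z \<otimes>\<^bsub>R\<^esub>
            k (inv\<^bsub>G\<^esub> z \<otimes>\<^bsub>G\<^esub> (inv\<^bsub>G\<^esub> y \<otimes>\<^bsub>G\<^esub> x)))"
          by (rule R.finsum_rdistr[symmetric]) (use val f h k fin in auto)
        also have "\<dots> = ?r"
          using mult[OF _ h k fin[OF h] order_refl, of "inv\<^bsub>G\<^esub> y \<otimes>\<^bsub>G\<^esub> x"] x yG by simp
        finally show ?thesis .
      qed
      have "((f \<otimes>\<^bsub>?S\<^esub> h) \<otimes>\<^bsub>?S\<^esub> k) x =
          (\<Oplus>\<^bsub>R\<^esub>w \<in> W. (f \<otimes>\<^bsub>?S\<^esub> h) w \<otimes>\<^bsub>R\<^esub> k (inv\<^bsub>G\<^esub> w \<otimes>\<^bsub>G\<^esub> x))"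
        by (rule mult[OF x closed[OF f h] k W(1)]) (use supp_mult f h W_def in auto)
      also have "\<dots> = (\<Oplus>\<^bsub>R\<^esub>w \<in> W. \<Oplus>\<^bsub>R\<^esub>y \<in> supp f.
          f y \<otimes>\<^bsub>R\<^esub> h (inv\<^bsub>G\<^esub> y \<otimes>\<^bsub>G\<^esub> w) \<otimes>\<^bsub>R\<^esub> k (inv\<^bsub>G\<^esub> w \<otimes>\<^bsub>G\<^esub> x))"
      proof (rule R.finsum_cong')
        fix w assume "w \<in> W"
        hence w: "w \<in> carrier G" using W by auto
        show "(f \<otimes>\<^bsub>?S\<^esub> h) w \<otimes>\<^bsub>R\<^esub> k (inv\<^bsub>G\<^esub> w \<otimes>\<^bsub>G\<^esub> x) = (\<Oplus>\<^bsub>R\<^esub>y \<in> supp f.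
          f y \<otimes>\<^bsub>R\<^esub> h (inv\<^bsub>G\<^esub> y \<otimes>\<^bsub>G\<^esub> w) \<otimes>\<^bsub>R\<^esub> k (inv\<^bsub>G\<^esub> w \<otimes>\<^bsub>G\<^esub> x))"
          unfolding mult[OF w f h fin[OF f] order_refl]
          by (rule R.finsum_ldistr) (use val f h k fin in auto)
      qed (use val f h k in \<open>auto intro!: R.finsum_closed\<close>)
      also have "\<dots> = (\<Oplus>\<^bsub>R\<^esub>y \<in> supp f. \<Oplus>\<^bsub>R\<^esub>w \<in> W.
          f y \<otimes>\<^bsub>R\<^esub> h (inv\<^bsub>G\<^esub> y \<otimes>\<^bsub>G\<^esub> w) \<otimes>\<^bsub>R\<^esub> k (inv\<^bsub>G\<^esub> w \<otimes>\<^bsub>G\<^esub> x))"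
        by (rule R.finsum_swap) (use val f h k fin W in auto)
      also have "\<dots> = (\<Oplus>\<^bsub>R\<^esub>y \<in> supp f. f y \<otimes>\<^bsub>R\<^esub> (h \<otimes>\<^bsub>?S\<^esub> k) (inv\<^bsub>G\<^esub> y \<otimes>\<^bsub>G\<^esub> x))"
        by (rule R.finsum_cong') (use val f closed[OF h k] inner in auto)
      also have "\<dots> = (f \<otimes>\<^bsub>?S\<^esub> (h \<otimes>\<^bsub>?S\<^esub> k)) x"
        by (rule mult[symmetric]) (use x f closed[OF h k] fin in auto)
      finally show ?thesis .
    qed (simp add: mult0)
  qed
  show ?thesis
  proof (rule ringI)
    show "abelian_group ?S"
    proof (rule abelian_groupI)
      fix f h assume f: "f \<in> carrier ?S" and h: "h \<in> carrier ?S"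
      have "supp (f \<oplus>\<^bsub>?S\<^esub> h) \<subseteq> supp f \<union> supp h"
        using f h val by (auto simp: supp_def add)
      hence "finite (supp (f \<oplus>\<^bsub>?S\<^esub> h))"
        by (rule finite_subset) (use fin f h in auto)
      thus "f \<oplus>\<^bsub>?S\<^esub> h \<in> carrier ?S" using f h by (simp add: car add)
      show "f \<oplus>\<^bsub>?S\<^esub> h = h \<oplus>\<^bsub>?S\<^esub> f" using f h val by (simp add: add R.a_comm)
    next
      fix f assume f: "f \<in> carrier ?S"
      have "supp (\<lambda>x. \<ominus>\<^bsub>R\<^esub> f x) = supp f"
        using f val by (auto simp: supp_def)
      hence "(\<lambda>x. \<ominus>\<^bsub>R\<^esub> f x) \<in> carrier ?S" using f by (simp add: car)
      thus "\<exists>h\<in>carrier ?S. h \<oplus>\<^bsub>?S\<^esub> f = \<zero>\<^bsub>?S\<^esub>"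
        using f val by (auto simp: add zero R.l_neg intro!: bexI[of _ "\<lambda>x. \<ominus>\<^bsub>R\<^esub> f x"])
      show "\<zero>\<^bsub>?S\<^esub> \<oplus>\<^bsub>?S\<^esub> f = f" using f val by (simp add: add zero)
    qed (use val in \<open>auto simp: car add zero R.a_assoc, simp add: supp_def\<close>)
    show "monoid ?S"
    proof (rule monoidI)
      have s1: "supp \<one>\<^bsub>?S\<^esub> \<subseteq> {\<one>\<^bsub>G\<^esub>}" by (auto simp: supp_def one)
      show oneC: "\<one>\<^bsub>?S\<^esub> \<in> carrier ?S"
        using finite_subset[OF s1] by (auto simp: car) (auto simp: one)
      fix f assume f: "f \<in> carrier ?S"
      show "\<one>\<^bsub>?S\<^esub> \<otimes>\<^bsub>?S\<^esub> f = f"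
      proof
        fix x
        show "(\<one>\<^bsub>?S\<^esub> \<otimes>\<^bsub>?S\<^esub> f) x = f x"
        proof (cases "x \<in> carrier G")
          case True
          have "(\<one>\<^bsub>?S\<^esub> \<otimes>\<^bsub>?S\<^esub> f) x = (\<Oplus>\<^bsub>R\<^esub>y \<in> {\<one>\<^bsub>G\<^esub>}. \<one>\<^bsub>?S\<^esub> y \<otimes>\<^bsub>R\<^esub> f (inv\<^bsub>G\<^esub> y \<otimes>\<^bsub>G\<^esub> x))"
            by (rule mult[OF True oneC f _ s1]) simp
          thus ?thesis using True f val by (simp add: one)
        qed (use f in \<open>simp add: mult0 car\<close>)
      qed
      show "f \<otimes>\<^bsub>?S\<^esub> \<one>\<^bsub>?S\<^esub> = f"
      proof
        fix x
        show "(f \<otimes>\<^bsub>?S\<^esub> \<one>\<^bsub>?S\<^esub>) x = f x"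
        proof (cases "x \<in> carrier G")
          case True
          have *: "inv\<^bsub>G\<^esub> y \<otimes>\<^bsub>G\<^esub> x = \<one>\<^bsub>G\<^esub> \<longleftrightarrow> y = x" if "y \<in> insert x (supp f)" for y
            using that sub[OF f] True by (metis G.inv_equality G.inv_inv G.inv_closed G.l_inv insert_iff subsetD)
          have "(f \<otimes>\<^bsub>?S\<^esub> \<one>\<^bsub>?S\<^esub>) x =
              (\<Oplus>\<^bsub>R\<^esub>y \<in> insert x (supp f). f y \<otimes>\<^bsub>R\<^esub> \<one>\<^bsub>?S\<^esub> (inv\<^bsub>G\<^esub> y \<otimes>\<^bsub>G\<^esub> x))"
            by (rule mult) (use True oneC f fin in auto)
          also have "\<dots> = (\<Oplus>\<^bsub>R\<^esub>y \<in> insert x (supp f). if x = y then f y else \<zero>\<^bsub>R\<^esub>)"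
            by (rule R.finsum_cong') (use * val f in \<open>auto simp: one\<close>)
          also have "\<dots> = f x"
            by (rule R.finsum_singleton) (use val f fin in auto)
          finally show ?thesis .
        qed (use f in \<open>simp add: mult0 car\<close>)
      qed
    qed (use closed assoc in auto)
    have addC: "f \<oplus>\<^bsub>?S\<^esub> h \<in> carrier ?S" if "f \<in> carrier ?S" "h \<in> carrier ?S" for f h
      using abelian_monoid.a_closed[OF abelian_group.axioms(1)[OF \<open>abelian_group ?S\<close>]] that by blast
    fix f h k assume f: "f \<in> carrier ?S" and h: "h \<in> carrier ?S" and k: "k \<in> carrier ?S"
    show "(f \<oplus>\<^bsub>?S\<^esub> h) \<otimes>\<^bsub>?S\<^esub> k = f \<otimes>\<^bsub>?S\<^esub> k \<oplus>\<^bsub>?S\<^esub> h \<otimes>\<^bsub>?S\<^esub> k"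
    proof
      fix x
      show "((f \<oplus>\<^bsub>?S\<^esub> h) \<otimes>\<^bsub>?S\<^esub> k) x = (f \<otimes>\<^bsub>?S\<^esub> k \<oplus>\<^bsub>?S\<^esub> h \<otimes>\<^bsub>?S\<^esub> k) x"
      proof (cases "x \<in> carrier G")
        case True
        let ?A = "supp f \<union> supp h"
        have A: "finite ?A" "supp f \<subseteq> ?A" "supp h \<subseteq> ?A" "supp (f \<oplus>\<^bsub>?S\<^esub> h) \<subseteq> ?A"
          using f h val fin by (auto simp: supp_def add)
        have "((f \<oplus>\<^bsub>?S\<^esub> h) \<otimes>\<^bsub>?S\<^esub> k) x
          = (\<Oplus>\<^bsub>R\<^esub>y \<in> ?A. (f \<oplus>\<^bsub>?S\<^esub> h) y \<otimes>\<^bsub>R\<^esub> k (inv\<^bsub>G\<^esub> y \<otimes>\<^bsub>G\<^esub> x))"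
          by (rule mult) (use True A addC f h k in auto)
        also have "\<dots> = (\<Oplus>\<^bsub>R\<^esub>y \<in> ?A. f y \<otimes>\<^bsub>R\<^esub> k (inv\<^bsub>G\<^esub> y \<otimes>\<^bsub>G\<^esub> x) \<oplus>\<^bsub>R\<^esub>
            h y \<otimes>\<^bsub>R\<^esub> k (inv\<^bsub>G\<^esub> y \<otimes>\<^bsub>G\<^esub> x))"
          by (rule R.finsum_cong') (use val f h k in \<open>auto simp: add R.l_distr\<close>)
        also have "\<dots> = (\<Oplus>\<^bsub>R\<^esub>y \<in> ?A. f y \<otimes>\<^bsub>R\<^esub> k (inv\<^bsub>G\<^esub> y \<otimes>\<^bsub>G\<^esub> x)) \<oplus>\<^bsub>R\<^esub>
            (\<Oplus>\<^bsub>R\<^esub>y \<in> ?A. h y \<otimes>\<^bsub>R\<^esub> k (inv\<^bsub>G\<^esub> y \<otimes>\<^bsub>G\<^esub> x))"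
          by (rule R.finsum_addf) (use val f h k in auto)
        also have "\<dots> = (f \<otimes>\<^bsub>?S\<^esub> k \<oplus>\<^bsub>?S\<^esub> h \<otimes>\<^bsub>?S\<^esub> k) x"
          using mult[OF True f k A(1,2)] mult[OF True h k A(1,3)] by (simp add: add)
        finally show ?thesis .
      qed (simp add: mult0 add)
    qed
    show "k \<otimes>\<^bsub>?S\<^esub> (f \<oplus>\<^bsub>?S\<^esub> h) = k \<otimes>\<^bsub>?S\<^esub> f \<oplus>\<^bsub>?S\<^esub> k \<otimes>\<^bsub>?S\<^esub> h"
    proof
      fix x
      show "(k \<otimes>\<^bsub>?S\<^esub> (f \<oplus>\<^bsub>?S\<^esub> h)) x = (k \<otimes>\<^bsub>?S\<^esub> f \<oplus>\<^bsub>?S\<^esub> k \<otimes>\<^bsub>?S\<^esub> h) x"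
      proof (cases "x \<in> carrier G")
        case True
        note m = mult[OF True k _ fin[OF k] order_refl]
        have "(k \<otimes>\<^bsub>?S\<^esub> (f \<oplus>\<^bsub>?S\<^esub> h)) x
          = (\<Oplus>\<^bsub>R\<^esub>y \<in> supp k. k y \<otimes>\<^bsub>R\<^esub> f (inv\<^bsub>G\<^esub> y \<otimes>\<^bsub>G\<^esub> x) \<oplus>\<^bsub>R\<^esub>
            k y \<otimes>\<^bsub>R\<^esub> h (inv\<^bsub>G\<^esub> y \<otimes>\<^bsub>G\<^esub> x))"
          unfolding m[OF addC[OF f h]]
          by (rule R.finsum_cong') (use val f h k in \<open>auto simp: add R.r_distr\<close>)
        also have "\<dots> = (\<Oplus>\<^bsub>R\<^esub>y \<in> supp k. k y \<otimes>\<^bsub>R\<^esub> f (inv\<^bsub>G\<^esub> y \<otimes>\<^bsub>G\<^esub> x)) \<oplus>\<^bsub>R\<^esub>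
            (\<Oplus>\<^bsub>R\<^esub>y \<in> supp k. k y \<otimes>\<^bsub>R\<^esub> h (inv\<^bsub>G\<^esub> y \<otimes>\<^bsub>G\<^esub> x))"
          by (rule R.finsum_addf) (use val f h k in auto)
        also have "\<dots> = (k \<otimes>\<^bsub>?S\<^esub> f \<oplus>\<^bsub>?S\<^esub> k \<otimes>\<^bsub>?S\<^esub> h) x"
          using m[OF f] m[OF h] by (simp add: add)
        finally show ?thesis .
      qed (simp add: mult0 add)
    qed
  qed
qed


section \<open>The Jacobson radical\<close>

text \<open>The library's \<open>ideal\<close> and \<open>maximalideal\<close> are two-sided, hence the one-sided versions.\<close>

definition left_ideal :: "'a set \<Rightarrow> ('a, 'm) ring_scheme \<Rightarrow> bool"
  where "left_ideal I S \<longleftrightarrow>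
    additive_subgroup I S \<and> (\<forall>r \<in> carrier S. \<forall>a \<in> I. r \<otimes>\<^bsub>S\<^esub> a \<in> I)"

definition maximal_left_ideal :: "'a set \<Rightarrow> ('a, 'm) ring_scheme \<Rightarrow> bool"
  where "maximal_left_ideal I S \<longleftrightarrow>
    left_ideal I S \<and> I \<noteq> carrier S \<and>
    (\<forall>K. left_ideal K S \<and> I \<subseteq> K \<longrightarrow> K = I \<or> K = carrier S)"

text \<open>The intersection with the carrier matters only for the zero ring, which has no maximal left
  ideal and is its own radical.\<close>

definition jacobson_radical :: "('a, 'm) ring_scheme \<Rightarrow> 'a set"
  where "jacobson_radical S = carrier S \<inter> \<Inter>{I. maximal_left_ideal I S}"


section \<open>$W\Delta U$ rings\<close>

definition Delta :: "('a, 'm) ring_scheme \<Rightarrow> 'a set"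
  where "Delta S = {r \<in> carrier S. \<forall>u \<in> Units S. r \<oplus>\<^bsub>S\<^esub> u \<in> Units S}"

definition WDU :: "('a, 'm) ring_scheme \<Rightarrow> bool"
  where "WDU S \<longleftrightarrow>
    Units S = (\<one>\<^bsub>S\<^esub> <+\<^bsub>S\<^esub> Delta S) \<union> ((\<ominus>\<^bsub>S\<^esub> \<one>\<^bsub>S\<^esub>) <+\<^bsub>S\<^esub> Delta S)"


section \<open>Locally finite groups and \<open>p\<close>-groups\<close>

definition locally_finite_group :: "('g, 'n) monoid_scheme \<Rightarrow> bool"
  where "locally_finite_group G \<longleftrightarrow>
    group G \<and> (\<forall>A. A \<subseteq> carrier G \<and> finite A \<longrightarrow> finite (generate G A))"

text \<open>\<open>group.ord\<close> is 0 for elements of infinite order, which is not a power of a prime.\<close>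

definition p_group :: "nat \<Rightarrow> ('g, 'n) monoid_scheme \<Rightarrow> bool"
  where "p_group p G \<longleftrightarrow> group G \<and> (\<forall>x \<in> carrier G. \<exists>n::nat. group.ord G x = p ^ n)"

end

theory Submission
  imports Defs
begin

text \<open>
  The constants embed \<open>R\<close> into \<open>RG\<close> and the augmentation \<open>\<epsilon>\<close> is a retraction onto \<open>R\<close>, so \<open>W\<Delta>U\<close> descends
  from \<open>RG\<close> to \<open>R\<close>. Conversely it lifts along every ring homomorphism that reflects units, and under the
  hypotheses of (2) the augmentation does: as \<open>G\<close> is locally finite one may assume that it is finite and
  that \<open>\<epsilon> x = 1\<close>. If \<open>x\<close> were in a maximal left ideal \<open>M\<close> of \<open>RG\<close>, then \<open>p \<in> M\<close> by Nakayama's lemma, so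
  \<open>RG/M\<close> is an elementary abelian \<open>p\<close>-group on which the \<open>p\<close>-group \<open>G\<close> has a nonzero fixed vector. The fixed
  vectors are a submodule of the simple module \<open>RG/M\<close>, hence \<open>G\<close> acts trivially on it, and
  \<open>1 = \<epsilon> x\<close> is congruent to \<open>x\<close> modulo \<open>M\<close>, a contradiction.
\<close>

section \<open>Finite p-groups acting on elementary abelian p-groups\<close>

text \<open>Induction on \<open>A\<close>: by commutativity the product of the finite subgroup
  generated by \<open>A\<close> with the finite cyclic group generated by \<open>a\<close> is again
  a subgroup. It is finite and contains all generators.\<close>

lemma (in comm_group) finite_generate_torsion:
  assumes "finite A" "A \<subseteq> carrier G" "\<And>a. a \<in> A \<Longrightarrow> ord a \<noteq> 0"
  shows "finite (generate G A)"
  using assms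
proof (induction A rule: finite_induct)
  case empty
  then show ?case by (simp add: generate_empty)
next
  case (insert a A)
  have sub: "subgroup (generate G A <#> generate G {a}) G"
    using insert.prems by (intro mult_subgroups generate_is_subgroup) auto
  \<comment> \<open>Infinite sets have \<open>card\<close> 0, so a cyclic subgroup whose cardinality
    is the nonzero \<open>ord a\<close> is finite.\<close>
  have "finite (generate G {a})"
    using insert.prems generate_pow_card[of a] by (metis card.infinite insert_subset insertI1)
  hence fin: "finite (generate G A <#> generate G {a})"
    using insert by (simp add: set_mult_def)
  have "a \<in> generate G A <#> generate G {a}"
    using insert.prems generate.one[of G A] generate.incl[of a "{a}" G] l_one[of a]
    unfolding set_mult_def by fastforce
  moreover have "b \<in> generate G A <#> generate G {a}" if "b \<in> A" for b
    using that insert.prems generate.one[of G "{a}"] generate.incl[of b A G] r_one[of b]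
    unfolding set_mult_def by fastforce
  ultimately have "insert a A \<subseteq> generate G A <#> generate G {a}" by blast
  thus ?case
    using generate_subgroup_incl[OF _ sub] fin by (meson finite_subset)
qed

text \<open>\<open>p_group\<close> speaks of the orders of elements, while counting orbits needs the
  order of the group. Cauchy's theorem connects them: a prime \<open>q\<close> dividing
  \<open>d\<close> is the order of some element, which is a power of \<open>p\<close>, so
  \<open>q = p\<close>.\<close>

lemma finite_p_group_divisor:
  assumes p: "Factorial_Ring.prime p" and H: "p_group p H" "finite (carrier H)"
    and d: "d dvd order H" "d \<noteq> 1"
  shows "p dvd d"
proof -
  interpret group H using H(1) by (simp add: p_group_def)
  obtain q where q: "Factorial_Ring.prime q" "q dvd d"
    using d(2) prime_factor_nat by blast
  \<comment> \<open>With exponent 1 Sylow's theorem yields a subgroup of order \<open>q\<close>;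
    \<open>m\<close> may still be divisible by \<open>q\<close>.\<close>
  then obtain m where "order H = q ^ 1 * m"
    using d(1) by (metis dvd_def dvd_trans power_one_right)
  from sylow_thm[OF q(1) group_axioms this H(2)] obtain K
    where K: "subgroup K H" "card K = q" by auto
  have "q > 1" using q(1) prime_gt_1_nat by blast
  then obtain x where x: "x \<in> K" "x \<noteq> \<one>\<^bsub>H\<^esub>"
    using K by (metis (no_types, lifting) card_1_singleton_iff less_irrefl One_nat_def is_singletonI'
        is_singleton_altdef subgroup.one_closed empty_iff)
  have xH: "x \<in> carrier H" using x(1) subgroup.subset[OF K(1)] by blast
  have "x [^]\<^bsub>H\<^esub> q = \<one>\<^bsub>H\<^esub>"
  proof -
    interpret K: group "H\<lparr>carrier := K\<rparr>" using K(1) subgroup_imp_group by blast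
    have "finite K" using subgroup.subset[OF K(1)] H(2) finite_subset by blast
    hence "x [^]\<^bsub>H\<lparr>carrier := K\<rparr>\<^esub> q = \<one>\<^bsub>H\<lparr>carrier := K\<rparr>\<^esub>"
      using K.pow_order_eq_1[of x] x K(2) by (simp add: order_def)
    thus ?thesis using nat_pow_consistent[of x q K] by simp
  qed
  hence "ord x dvd q" using xH pow_eq_id by blast
  moreover have "ord x \<noteq> 1" using x xH ord_eq_1 by blast
  ultimately have "ord x = q" using q(1) prime_nat_iff by blast
  moreover obtain n where "ord x = p ^ n" using H(1) xH by (auto simp: p_group_def)
  ultimately have "q dvd p" using q(1) by (metis dvd_refl prime_dvd_power)
  hence "q = p" using p q(1) by (simp add: primes_dvd_imp_eq)
  thus ?thesis using q(2) by simp
qed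

text \<open>The class equation modulo \<open>p\<close>: the points that are not fixed fall into
  disjoint orbits of size different from 1. Each size divides the order of the group and hence is a
  multiple of \<open>p\<close>.\<close>

lemma (in group_action) dvd_card_fixed_points:
  assumes p: "Factorial_Ring.prime p" "p_group p G" "finite (carrier G)"
    and E: "finite E" "p dvd card E"
  shows "p dvd card {x \<in> E. \<forall>g \<in> carrier G. \<phi> g x = x}"
proof -
  let ?F = "{x \<in> E. \<forall>g \<in> carrier G. \<phi> g x = x}"
  interpret group G using p(2) by (simp add: p_group_def)
  have orb_fixed: "x \<in> ?F" if x: "x \<in> E" and c: "card (orbit G \<phi> x) = 1" for x
  proof -
    have "\<phi> g x = x" if "g \<in> carrier G" for g
    proof -
      have "\<phi> g x \<in> orbit G \<phi> x" using that by (auto simp: orbit_def)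
      moreover have "x \<in> orbit G \<phi> x" using orbit_refl x by blast
      ultimately show ?thesis using c by (metis card_1_singletonE singletonD)
    qed
    thus ?thesis using x by auto
  qed
  \<comment> \<open>The orbits that are not singletons, which together make up the complement of the
    fixed points.\<close>
  let ?C = "{orb \<in> orbits G E \<phi>. card orb \<noteq> 1}"
  have "\<Union> ?C = E - ?F"
  proof
    show "\<Union> ?C \<subseteq> E - ?F"
    proof
      fix y assume "y \<in> \<Union> ?C"
      then obtain orb where orb: "orb \<in> orbits G E \<phi>" "card orb \<noteq> 1" "y \<in> orb" by auto
      have yE: "y \<in> E" using orb orbits_coverture by auto
      have "orbit G \<phi> y \<in> orbits G E \<phi>" using yE by (auto simp: orbits_def)
      with orb yE have eq: "orb = orbit G \<phi> y"
        using disjoint_union orbit_refl by blast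
      have "y \<notin> ?F"
      proof
        assume "y \<in> ?F"
        hence "orbit G \<phi> y = {y}" using one_closed by (force simp: orbit_def)
        with eq orb(2) show False by simp
      qed
      thus "y \<in> E - ?F" using yE by blast
    qed
    show "E - ?F \<subseteq> \<Union> ?C"
    proof
      fix y assume y: "y \<in> E - ?F"
      hence "card (orbit G \<phi> y) \<noteq> 1" using orb_fixed by blast
      moreover have "y \<in> orbit G \<phi> y" using y orbit_refl by blast
      ultimately show "y \<in> \<Union> ?C" using y by (auto simp: orbits_def)
    qed
  qed
  moreover have "p dvd card (\<Union> ?C)"
  proof (rule dvd_partition)
    show "finite (\<Union> ?C)" using \<open>\<Union> ?C = E - ?F\<close> E(1) by simp
    show "\<forall>c\<in>?C. p dvd card c"
    proof
      fix c assume c: "c \<in> ?C"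
      then obtain x where "x \<in> E" "c = orbit G \<phi> x" by (auto simp: orbits_def)
      hence "card c dvd order G" using orbit_stabilizer_theorem by (metis dvd_triv_left)
      thus "p dvd card c" using c finite_p_group_divisor[OF p] by blast
    qed
    show "\<forall>c1\<in>?C. \<forall>c2\<in>?C. c1 \<noteq> c2 \<longrightarrow> c1 \<inter> c2 = {}"
      using disjoint_union by blast
  qed
  ultimately have "p dvd card (E - ?F)" by simp
  moreover have "card E = card (E - ?F) + card ?F"
    using E(1) by (metis (no_types, lifting) card_Diff_subset card_mono finite_subset le_add_diff_inverse2 mem_Collect_eq subsetI)
  ultimately show ?thesis using E(2) dvd_add_right_iff[of p "card (E - ?F)" "card ?F"] by simp
qed

text \<open>\<open>Q\<close> may be infinite, so fixed points are counted in a finite invariant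
  subgroup containing \<open>y\<close>. Their number is divisible by \<open>p\<close> and positive,
  since the neutral element is fixed; hence there is another one. \<open>Q\<close> is written
  multiplicatively because it will be a factor group \<open>R A_Mod M\<close>.\<close>

lemma p_group_fixed_vector:
  assumes p: "Factorial_Ring.prime p" "p_group p H" "finite (carrier H)"
    and Q: "comm_group Q" "\<And>x. x \<in> carrier Q \<Longrightarrow> x [^]\<^bsub>Q\<^esub> p = \<one>\<^bsub>Q\<^esub>"
    and hom: "\<And>h. h \<in> carrier H \<Longrightarrow> \<phi> h \<in> hom Q Q"
    and mult: "\<And>h k x. h \<in> carrier H \<Longrightarrow> k \<in> carrier H \<Longrightarrow> x \<in> carrier Q \<Longrightarrow>
      \<phi> (h \<otimes>\<^bsub>H\<^esub> k) x = \<phi> h (\<phi> k x)"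
    and one: "\<And>x. x \<in> carrier Q \<Longrightarrow> \<phi> \<one>\<^bsub>H\<^esub> x = x"
    and nontriv: "y \<in> carrier Q" "y \<noteq> \<one>\<^bsub>Q\<^esub>"
  shows "\<exists>v \<in> carrier Q. v \<noteq> \<one>\<^bsub>Q\<^esub> \<and> (\<forall>h \<in> carrier H. \<phi> h v = v)"
proof -
  interpret H: group H using p(2) by (simp add: p_group_def)
  interpret Q: comm_group Q by fact
  have gh: "group_hom Q Q (\<phi> h)" if "h \<in> carrier H" for h
    using hom[OF that] by (simp add: group_hom_def group_hom_axioms_def Q.is_group)
  have phi_closed: "\<phi> h x \<in> carrier Q" if "h \<in> carrier H" "x \<in> carrier Q" for h x
    using hom[OF that(1)] that(2) by (auto simp: hom_def)
  \<comment> \<open>The orbit of \<open>y\<close> is finite and permuted by \<open>H\<close>. The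
    subgroup \<open>W\<close> that it generates is therefore invariant, and finite because
    \<open>Q\<close> is abelian of exponent dividing \<open>p\<close>.\<close>
  define A where "A = (\<lambda>h. \<phi> h y) ` carrier H"
  define W where "W = generate Q A"
  have A: "finite A" "A \<subseteq> carrier Q" "y \<in> A"
    using p(3) phi_closed nontriv one[of y] by (auto simp: A_def image_iff intro!: bexI[of _ "\<one>\<^bsub>H\<^esub>"])
  have "group.ord Q a \<noteq> 0" if "a \<in> carrier Q" for a
  proof -
    have "group.ord Q a dvd p" using Q(2)[OF that] that Q.pow_eq_id by blast
    thus ?thesis using prime_gt_0_nat[OF p(1)] by (metis dvd_0_left_iff less_irrefl)
  qed
  hence finW: "finite W"
    using A unfolding W_def by (intro Q.finite_generate_torsion) blast+
  have W: "subgroup W Q" using A Q.generate_is_subgroup by (simp add: W_def)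
  have WQ: "W \<subseteq> carrier Q" using W subgroup.subset by blast
  have inv: "\<phi> h x \<in> W" if h: "h \<in> carrier H" and x: "x \<in> W" for h x
  proof -
    have "\<phi> h ` A \<subseteq> A" using h mult nontriv(1)
      by (force simp: A_def intro!: H.m_closed)
    moreover have "\<phi> h ` W = generate Q (\<phi> h ` A)"
      unfolding W_def using group_hom.generate_img[OF gh[OF h]] A by blast
    ultimately show ?thesis
      using x Q.mono_generate[of "\<phi> h ` A" A] by (auto simp: W_def)
  qed
  \<comment> \<open>\<open>BijGroup\<close> consists of extensional functions, hence the restriction
    of each map to \<open>W\<close>.\<close>
  have "group_action H W (\<lambda>h. \<lambda>x\<in>W. \<phi> h x)"
  proof -
    have bij: "(\<lambda>x\<in>W. \<phi> h x) \<in> Bij W" if h: "h \<in> carrier H" for h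
    proof -
      have "bij_betw (\<phi> h) W W"
        by (rule bij_betw_byWitness[of _ "\<phi> (inv\<^bsub>H\<^esub> h)"])
           (use h inv WQ mult[symmetric] one in \<open>auto simp: subset_iff\<close>)
      thus ?thesis by (simp add: Bij_def)
    qed
    have "(\<lambda>h. \<lambda>x\<in>W. \<phi> h x) \<in> hom H (BijGroup W)"
    proof (rule homI)
      fix h k assume hk: "h \<in> carrier H" "k \<in> carrier H"
      show "(\<lambda>x\<in>W. \<phi> (h \<otimes>\<^bsub>H\<^esub> k) x) = (\<lambda>x\<in>W. \<phi> h x) \<otimes>\<^bsub>BijGroup W\<^esub> (\<lambda>x\<in>W. \<phi> k x)"
        using hk bij mult WQ inv by (auto simp: BijGroup_def compose_def fun_eq_iff subset_iff)
    qed (use bij in \<open>simp add: BijGroup_def\<close>)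
    thus ?thesis
      by (simp add: group_action_def group_hom_def group_hom_axioms_def H.is_group group_BijGroup)
  qed
  then interpret act: group_action H W "\<lambda>h. \<lambda>x\<in>W. \<phi> h x" .
  \<comment> \<open>By Lagrange's theorem, as \<open>y\<close> has order exactly \<open>p\<close>
    and generates a subgroup of \<open>W\<close>.\<close>
  have "p dvd card W"
  proof -
    have "group.ord Q y = p"
    proof -
      have "group.ord Q y dvd p" using Q(2)[OF nontriv(1)] nontriv(1) Q.pow_eq_id by blast
      moreover have "group.ord Q y \<noteq> 1" using nontriv Q.ord_eq_1 by blast
      ultimately show ?thesis using p(1) prime_nat_iff by blast
    qed
    moreover have "generate Q {y} \<subseteq> W"
      using Q.mono_generate[of "{y}" A] A by (simp add: W_def)
    moreover have "subgroup (generate Q {y}) (Q\<lparr>carrier := W\<rparr>)"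
      using calculation W nontriv(1) Q.generate_is_subgroup[of "{y}"]
      by (simp add: Q.subgroup_incl)
    hence "card (generate Q {y}) dvd order (Q\<lparr>carrier := W\<rparr>)"
      using group.lagrange[OF Q.subgroup_imp_group[OF W]] by (metis dvd_triv_right)
    ultimately show ?thesis
      using Q.generate_pow_card[OF nontriv(1)] by (simp add: order_def)
  qed
  from act.dvd_card_fixed_points[OF p finW this]
  have dvd: "p dvd card {x \<in> W. \<forall>h \<in> carrier H. (\<lambda>x\<in>W. \<phi> h x) x = x}" (is "p dvd card ?F") .
  have "\<one>\<^bsub>Q\<^esub> \<in> ?F"
    using subgroup.one_closed[OF W] gh by (auto simp: group_hom.hom_one)
  hence "card ?F \<noteq> 0" using finW by auto
  moreover have "card ?F \<noteq> 1" using dvd p(1) not_prime_1 by (metis nat_dvd_1_iff_1)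
  ultimately have "\<not> ?F \<subseteq> {\<one>\<^bsub>Q\<^esub>}"
    using subset_singletonD by fastforce
  then obtain v where "v \<in> ?F" "v \<noteq> \<one>\<^bsub>Q\<^esub>" by blast
  thus ?thesis using WQ by (auto simp: subset_iff)
qed

section \<open>One-sided ideals\<close>

text \<open>For a subring \<open>T\<close> these are the \<open>T\<close>-submodules of the ring
  under left multiplication. Two choices of \<open>T\<close> occur: the whole carrier, giving left
  ideals, and the constants of a group ring, giving its \<open>R\<close>-submodules.\<close>

definition submod :: "'a set \<Rightarrow> 'a set \<Rightarrow> ('a, 'm) ring_scheme \<Rightarrow> bool"
  where "submod T I S \<longleftrightarrow> additive_subgroup I S \<and> (\<forall>t \<in> T. \<forall>a \<in> I. t \<otimes>\<^bsub>S\<^esub> a \<in> I)"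

lemma left_ideal_iff_submod: "left_ideal I S \<longleftrightarrow> submod (carrier S) I S"
  by (simp add: left_ideal_def submod_def)

context ring
begin

lemma additive_subgroupI':
  assumes "I \<subseteq> carrier R" "\<zero> \<in> I" "\<And>a b. a \<in> I \<Longrightarrow> b \<in> I \<Longrightarrow> a \<oplus> b \<in> I"
    "\<And>a. a \<in> I \<Longrightarrow> \<ominus> a \<in> I"
  shows "additive_subgroup I R"
  using assms by unfold_locales (auto simp: a_inv_def)

lemma submodD:
  assumes "submod T I R"
  shows "I \<subseteq> carrier R" "\<zero> \<in> I" "\<And>a b. a \<in> I \<Longrightarrow> b \<in> I \<Longrightarrow> a \<oplus> b \<in> I"
    "\<And>a. a \<in> I \<Longrightarrow> \<ominus> a \<in> I" "\<And>a b. a \<in> I \<Longrightarrow> b \<in> I \<Longrightarrow> a \<ominus> b \<in> I"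
    "\<And>t a. t \<in> T \<Longrightarrow> a \<in> I \<Longrightarrow> t \<otimes> a \<in> I"
proof -
  interpret additive_subgroup I R using assms by (simp add: submod_def)
  show "I \<subseteq> carrier R" "\<zero> \<in> I" "\<And>a b. a \<in> I \<Longrightarrow> b \<in> I \<Longrightarrow> a \<oplus> b \<in> I"
    "\<And>a. a \<in> I \<Longrightarrow> \<ominus> a \<in> I"
    using a_subset subgroup.m_inv_closed[OF a_subgroup] by (auto simp: a_inv_def)
  thus "\<And>a b. a \<in> I \<Longrightarrow> b \<in> I \<Longrightarrow> a \<ominus> b \<in> I" by (simp add: a_minus_def)
  show "\<And>t a. t \<in> T \<Longrightarrow> a \<in> I \<Longrightarrow> t \<otimes> a \<in> I" using assms by (simp add: submod_def)
qed

text \<open>\<open>N\<close> is I + T a. It serves to enlarge a left ideal by one element and, for a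
  smaller \<open>T\<close>, as the induction step of Nakayama's lemma.\<close>

lemma submod_add_principal:
  assumes T: "subring T R" and I: "submod T I R" and a: "a \<in> carrier R"
  defines "N \<equiv> {i \<oplus> t \<otimes> a | i t. i \<in> I \<and> t \<in> T}"
  shows "submod T N R" "I \<subseteq> N" "a \<in> N"
proof -
  note I' = submodD[OF I] and TR = subringE[OF T]
  have IR: "i \<in> carrier R" if "i \<in> I" for i using I'(1) that by blast
  have TC: "t \<in> carrier R" if "t \<in> T" for t using TR(1) that by blast
  have "additive_subgroup N R"
  proof (rule additive_subgroupI')
    show "N \<subseteq> carrier R" using a IR TC by (auto simp: N_def)
    have "\<zero> = \<zero> \<oplus> \<zero> \<otimes> a" using a by simp
    thus "\<zero> \<in> N" using I'(2) TR(2) unfolding N_def by blast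
    fix x assume "x \<in> N"
    then obtain i t where x: "x = i \<oplus> t \<otimes> a" "i \<in> I" "t \<in> T" by (auto simp: N_def)
    have "\<ominus> x = \<ominus> i \<oplus> (\<ominus> t) \<otimes> a"
      using x IR TC a by (simp add: minus_add l_minus)
    thus "\<ominus> x \<in> N" using x I'(4) TR(5) unfolding N_def by blast
    fix y assume "y \<in> N"
    then obtain j s where y: "y = j \<oplus> s \<otimes> a" "j \<in> I" "s \<in> T" by (auto simp: N_def)
    have "x \<oplus> y = (i \<oplus> j) \<oplus> (t \<oplus> s) \<otimes> a"
      using x y IR TC a by (simp add: l_distr a_ac)
    thus "x \<oplus> y \<in> N" using x y I'(3) TR(7) unfolding N_def by blast
  qed
  moreover have "s \<otimes> x \<in> N" if s: "s \<in> T" and "x \<in> N" for s x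
  proof -
    obtain i t where x: "x = i \<oplus> t \<otimes> a" "i \<in> I" "t \<in> T" using \<open>x \<in> N\<close> by (auto simp: N_def)
    have "s \<otimes> x = s \<otimes> i \<oplus> (s \<otimes> t) \<otimes> a"
      using x s IR TC a by (simp add: r_distr m_assoc)
    thus ?thesis using x s I'(6) TR(6) unfolding N_def by blast
  qed
  ultimately show "submod T N R" by (simp add: submod_def)
  show "I \<subseteq> N"
  proof
    fix i assume i: "i \<in> I"
    hence "i = i \<oplus> \<zero> \<otimes> a" using IR a by simp
    thus "i \<in> N" using i TR(2) unfolding N_def by blast
  qed
  have "a = \<zero> \<oplus> \<one> \<otimes> a" using a by simp
  thus "a \<in> N" using I'(2) TR(3) unfolding N_def by blast
qed

section \<open>Maximal left ideals and the Jacobson radical\<close>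

lemma left_ideal_add_principal:
  assumes "left_ideal I R" "a \<in> carrier R"
  shows "left_ideal {i \<oplus> r \<otimes> a | i r. i \<in> I \<and> r \<in> carrier R} R"
  using submod_add_principal(1)[OF carrier_is_subring _ assms(2)] assms(1)
  by (simp add: left_ideal_iff_submod)

lemma left_ideal_eq_carrier:
  assumes "left_ideal I R" "\<one> \<in> I"
  shows "I = carrier R"
  using assms submodD(1,6)[of "carrier R" I] by (force simp: left_ideal_iff_submod)

text \<open>Zorn's lemma. Properness is expressed as not containing \<open>\<one>\<close>, a
  condition that visibly passes to unions of chains.\<close>

lemma exists_maximal_left_ideal:
  assumes I: "left_ideal I R" "I \<noteq> carrier R"
  shows "\<exists>M. maximal_left_ideal M R \<and> I \<subseteq> M"
proof -
  let ?A = "{K. left_ideal K R \<and> I \<subseteq> K \<and> \<one> \<notin> K}"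
  have "\<exists>M\<in>?A. \<forall>K\<in>?A. M \<subseteq> K \<longrightarrow> K = M"
  proof (rule subset_Zorn_nonempty)
    show "?A \<noteq> {}" using I left_ideal_eq_carrier by blast
    fix C assume ne: "C \<noteq> {}" and ch: "subset.chain ?A C"
    have C: "left_ideal K R" "I \<subseteq> K" "\<one> \<notin> K" if "K \<in> C" for K
      using ch that by (auto simp: subset_chain_def)
    note D = submodD[OF C(1)[unfolded left_ideal_iff_submod]]
    have "additive_subgroup (\<Union>C) R"
    proof (rule additive_subgroupI')
      show "\<zero> \<in> \<Union>C" using ne D(2) by blast
      fix a b assume "a \<in> \<Union>C" "b \<in> \<Union>C"
      then obtain K L where KL: "K \<in> C" "L \<in> C" "a \<in> K" "b \<in> L" by blast
      with ch have "K \<subseteq> L \<or> L \<subseteq> K" by (auto simp: subset_chain_def)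
      thus "a \<oplus> b \<in> \<Union>C" using KL D(3) by blast
    qed (use D(1,4) in blast)+
    moreover have "\<forall>r\<in>carrier R. \<forall>a\<in>\<Union>C. r \<otimes> a \<in> \<Union>C" using D(6) by blast
    ultimately have "left_ideal (\<Union>C) R" by (simp add: left_ideal_def)
    thus "\<Union>C \<in> ?A" using ne C by blast
  qed
  then obtain M where M: "left_ideal M R" "I \<subseteq> M" "\<one> \<notin> M"
    and max: "\<And>K. K \<in> ?A \<Longrightarrow> M \<subseteq> K \<Longrightarrow> K = M" by auto
  have "M \<noteq> carrier R" using M(3) by auto
  moreover have "K = M \<or> K = carrier R" if "left_ideal K R" "M \<subseteq> K" for K
    using that max[of K] M(2) left_ideal_eq_carrier by blast
  ultimately show ?thesis using M by (intro exI[of _ M]) (simp add: maximal_left_ideal_def)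
qed

lemma left_ideal_zero: "left_ideal {\<zero>} R"
  by (auto simp: left_ideal_def intro!: additive_subgroupI')

text \<open>Without a left inverse, the left ideal generated by 1 - r q would be proper and lie in a
  maximal left ideal. That ideal also contains q, hence r q, and so it would contain 1.\<close>

lemma jacobson_radical_left_inverse:
  assumes q: "q \<in> jacobson_radical R" and r: "r \<in> carrier R"
  shows "\<exists>s \<in> carrier R. s \<otimes> (\<one> \<ominus> r \<otimes> q) = \<one>"
proof (rule ccontr)
  assume no: "\<not> ?thesis"
  have qR: "q \<in> carrier R" using q by (simp add: jacobson_radical_def)
  let ?a = "\<one> \<ominus> r \<otimes> q"
  \<comment> \<open>The principal left ideal of \<open>?a\<close>, written as the zero ideal
    enlarged by \<open>?a\<close>.\<close>
  let ?I = "{i \<oplus> s \<otimes> ?a | i s. i \<in> {\<zero>} \<and> s \<in> carrier R}"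
  have a: "?a \<in> carrier R" using qR r by simp
  have I: "left_ideal ?I R" by (rule left_ideal_add_principal[OF left_ideal_zero a])
  have aI: "?a \<in> ?I" using a by (auto intro!: exI[of _ \<one>])
  have "\<one> \<notin> ?I"
  proof
    assume "\<one> \<in> ?I"
    then obtain s where "s \<in> carrier R" "\<one> = \<zero> \<oplus> s \<otimes> ?a" by blast
    thus False using no a by (metis l_zero m_closed)
  qed
  hence "?I \<noteq> carrier R" by blast
  then obtain M where M: "maximal_left_ideal M R" "?I \<subseteq> M"
    using exists_maximal_left_ideal[OF I] by blast
  have lM: "left_ideal M R" using M(1) by (simp add: maximal_left_ideal_def)
  note D = submodD[OF lM[unfolded left_ideal_iff_submod]]
  have "q \<in> M" using q M(1) by (auto simp: jacobson_radical_def)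
  hence "r \<otimes> q \<in> M" using D(6) r by blast
  moreover have "?a \<in> M" using aI M(2) by blast
  ultimately have "?a \<oplus> r \<otimes> q \<in> M" using D(3) by blast
  moreover have "?a \<oplus> r \<otimes> q = \<one>" using r qR by (simp add: a_minus_def a_assoc l_neg)
  ultimately have "M = carrier R" using left_ideal_eq_carrier lM by simp
  thus False using M(1) by (simp add: maximal_left_ideal_def)
qed

text \<open>A version of Nakayama's lemma in which finite generation of \<open>R\<close> over \<open>I\<close> is expressed without
  linear combinations. In the induction step one passes from \<open>I\<close> to \<open>I + T a\<close>.\<close>

lemma nakayama:
  assumes T: "subring T R" and q: "q \<in> T" "\<And>x. x \<in> carrier R \<Longrightarrow> q \<otimes> x = x \<otimes> q"
    and inv: "\<And>t. t \<in> T \<Longrightarrow> \<exists>s \<in> T. s \<otimes> (\<one> \<ominus> t \<otimes> q) = \<one>"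
    and I: "submod T I R" and A: "finite A" "A \<subseteq> carrier R"
    and gen: "\<And>N. submod T N R \<Longrightarrow> I \<subseteq> N \<Longrightarrow> A \<subseteq> N \<Longrightarrow> N = carrier R"
    and cover: "\<And>v. v \<in> carrier R \<Longrightarrow> \<exists>i \<in> I. \<exists>w \<in> carrier R. v = i \<oplus> q \<otimes> w"
  shows "I = carrier R"
  using A(1) I A(2) gen cover
proof (induction A arbitrary: I rule: finite_induct)
  case empty
  thus ?case by blast
next
  case (insert a A)
  have a: "a \<in> carrier R" using insert.prems by simp
  define N where "N = {i \<oplus> t \<otimes> a | i t. i \<in> I \<and> t \<in> T}"
  note N = submod_add_principal[OF T insert.prems(1) a, folded N_def]
  note D = submodD[OF insert.prems(1)]
  have TC: "t \<in> carrier R" if "t \<in> T" for t using subringE(1)[OF T] that by blast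
  have qR: "q \<in> carrier R" using TC q(1) by blast
  \<comment> \<open>The induction hypothesis is applied to \<open>N\<close>, for which
    \<open>A\<close> suffices as a generating set since \<open>a\<close> already lies in
    \<open>N\<close>.\<close>
  have NR: "N = carrier R"
  proof (rule insert.IH)
    show "submod T N R" by (rule N(1))
    show "A \<subseteq> carrier R" using insert.prems(2) by simp
    show "K = carrier R" if "submod T K R" "N \<subseteq> K" "A \<subseteq> K" for K
      using insert.prems(3)[OF that(1)] that N by blast
    show "\<exists>i\<in>N. \<exists>w\<in>carrier R. v = i \<oplus> q \<otimes> w" if "v \<in> carrier R" for v
      using insert.prems(4)[OF that] N(2) by blast
  qed
  \<comment> \<open>Expanding \<open>a\<close> by the covering hypothesis and then \<open>w\<close>
    by \<open>N = carrier R\<close> gives a = i + q (j + t a). So (1 - t q) a = i + q j lies in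
    \<open>I\<close>.\<close>
  obtain i w where iw: "i \<in> I" "w \<in> carrier R" "a = i \<oplus> q \<otimes> w"
    using insert.prems(4)[OF a] by blast
  obtain j t where jt: "j \<in> I" "t \<in> T" "w = j \<oplus> t \<otimes> a"
    using iw(2) unfolding NR[symmetric] N_def by blast
  have C: "i \<in> carrier R" "j \<in> carrier R" "t \<in> carrier R" using iw(1) jt(1,2) D(1) TC by auto
  let ?k = "i \<oplus> q \<otimes> j"
  have k: "?k \<in> I" using iw(1) jt(1) D(3,6) q(1) by blast
  have kC: "?k \<in> carrier R" using C qR by simp
  have "a = i \<oplus> q \<otimes> (j \<oplus> t \<otimes> a)" using iw(3) jt(3) by simp
  also have "\<dots> = ?k \<oplus> q \<otimes> (t \<otimes> a)" using C qR a by (simp add: r_distr a_assoc)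
  \<comment> \<open>Centrality of \<open>q\<close> brings the coefficient of \<open>a\<close> into
    the form to which the left inverse from \<open>inv\<close> applies.\<close>
  also have "q \<otimes> (t \<otimes> a) = (t \<otimes> q) \<otimes> a" using C qR a q(2)[of t] by (simp add: m_assoc[symmetric])
  finally have eq: "a = ?k \<oplus> (t \<otimes> q) \<otimes> a" .
  have tqa: "(t \<otimes> q) \<otimes> a \<in> carrier R" using C qR a by simp
  have "(\<one> \<ominus> t \<otimes> q) \<otimes> a = a \<ominus> (t \<otimes> q) \<otimes> a"
    using C qR a by (simp add: a_minus_def l_distr l_minus)
  also have "\<dots> = ?k" using eq tqa kC by (metis a_minus_def a_assoc r_neg r_zero a_inv_closed)
  finally have eq': "(\<one> \<ominus> t \<otimes> q) \<otimes> a = ?k" .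
  obtain s where s: "s \<in> T" "s \<otimes> (\<one> \<ominus> t \<otimes> q) = \<one>" using inv jt(2) by blast
  have "a = (s \<otimes> (\<one> \<ominus> t \<otimes> q)) \<otimes> a" using s a by simp
  also have "\<dots> = s \<otimes> ?k"
    unfolding eq'[symmetric] using TC[OF s(1)] C qR a by (intro m_assoc) simp_all
  finally have "a \<in> I" using s(1) k D(6) by metis
  have "x \<in> I" if "x \<in> N" for x
    using that D(3,6) \<open>a \<in> I\<close> by (auto simp: N_def)
  thus ?case using NR D(1) by blast
qed

end

section \<open>Fixed vectors modulo a left ideal\<close>

text \<open>\<open>H\<close> acts through \<open>\<delta>\<close> by left multiplication on the
  additive group R/M. This group is nonzero because \<open>M\<close> is proper, and killed by
  \<open>p\<close> because p 1 lies in \<open>M\<close>, so \<open>p_group_fixed_vector\<close>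
  applies. The conclusion is phrased with a representative \<open>v\<close> of the fixed
  coset.\<close>

lemma (in ring) exists_fixed_mod_left_ideal:
  assumes p: "Factorial_Ring.prime p" "p_group p H" "finite (carrier H)"
    and M: "left_ideal M R" "M \<noteq> carrier R" "[p] \<cdot> \<one> \<in> M"
    and hom: "\<delta> \<in> hom H R" "\<delta> \<one>\<^bsub>H\<^esub> = \<one>"
  shows "\<exists>v \<in> carrier R. v \<notin> M \<and> (\<forall>h \<in> carrier H. \<delta> h \<otimes> v \<ominus> v \<in> M)"
proof -
  interpret H: group H using p(2) by (simp add: p_group_def)
  have D: "M \<subseteq> carrier R" "\<zero> \<in> M" "\<And>a b. a \<in> M \<Longrightarrow> b \<in> M \<Longrightarrow> a \<oplus> b \<in> M"
    "\<And>r a. r \<in> carrier R \<Longrightarrow> a \<in> M \<Longrightarrow> r \<otimes> a \<in> M"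
    by (rule submodD[OF M(1)[unfolded left_ideal_iff_submod]]; assumption)+
  interpret M: abelian_subgroup M R
    using M(1) by (intro abelian_subgroupI3) (simp_all add: left_ideal_def abelian_group_axioms)
  let ?Q = "R A_Mod M"
  \<comment> \<open>Taking the image of the whole coset avoids a choice of representatives.\<close>
  define \<phi> where "\<phi> h C = (\<lambda>v. \<delta> h \<otimes> v) ` C" for h and C
  have \<delta>: "\<delta> h \<in> carrier R" if "h \<in> carrier H" for h
    using hom(1) that by (auto simp: hom_def)
  have \<delta>_mult: "\<delta> (h \<otimes>\<^bsub>H\<^esub> k) = \<delta> h \<otimes> \<delta> k" if "h \<in> carrier H" "k \<in> carrier H" for h k
    using hom(1) that by (auto simp: hom_def)
  have carQ: "carrier ?Q = {M +> v | v. v \<in> carrier R}"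
    by (auto simp: A_FactGroup_def' A_RCOSETS_def')
  have oneQ: "\<one>\<^bsub>?Q\<^esub> = M" by (simp add: A_FactGroup_def')
  have coset: "M +> v = {m \<oplus> v | m. m \<in> M}" for v
    by (auto simp: a_r_coset_def')
  have coset_self: "v \<in> M +> v" if "v \<in> carrier R" for v
    unfolding coset by (intro CollectI exI[of _ \<zero>]) (use D(2) that in simp)
  have \<phi>: "\<phi> h (M +> v) = M +> (\<delta> h \<otimes> v)" if h: "h \<in> carrier H" and v: "v \<in> carrier R" for h v
  proof
    show "\<phi> h (M +> v) \<subseteq> M +> (\<delta> h \<otimes> v)"
    proof
      fix x assume "x \<in> \<phi> h (M +> v)"
      then obtain m where m: "m \<in> M" "x = \<delta> h \<otimes> (m \<oplus> v)" by (auto simp: \<phi>_def coset)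
      hence "x = \<delta> h \<otimes> m \<oplus> \<delta> h \<otimes> v" using \<delta>[OF h] v D(1) by (auto simp: r_distr)
      thus "x \<in> M +> (\<delta> h \<otimes> v)" using m(1) D(4) \<delta>[OF h] by (auto simp: coset)
    qed
    show "M +> (\<delta> h \<otimes> v) \<subseteq> \<phi> h (M +> v)"
    proof
      fix x assume "x \<in> M +> (\<delta> h \<otimes> v)"
      then obtain m where m: "m \<in> M" "x = m \<oplus> \<delta> h \<otimes> v" by (auto simp: coset)
      \<comment> \<open>The image is the full coset because \<open>\<delta> h\<close> is invertible:
        \<open>?n\<close> is the preimage of \<open>m\<close>, and it stays in the left ideal
        \<open>M\<close>.\<close>
      let ?n = "\<delta> (inv\<^bsub>H\<^esub> h) \<otimes> m"
      have n: "?n \<in> M" using D(4) \<delta> h m(1) by simp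
      have "\<delta> h \<otimes> \<delta> (inv\<^bsub>H\<^esub> h) = \<one>" using h hom(2) \<delta>_mult[of h "inv\<^bsub>H\<^esub> h"] by simp
      hence "\<delta> h \<otimes> ?n = m"
        using h m(1) D(1) \<delta> by (simp add: m_assoc[symmetric] subset_iff)
      hence "x = \<delta> h \<otimes> (?n \<oplus> v)" using m n v h \<delta> D(1) by (simp add: r_distr subset_iff)
      thus "x \<in> \<phi> h (M +> v)" using n by (auto simp: \<phi>_def coset)
    qed
  qed
  have "\<exists>C \<in> carrier ?Q. C \<noteq> \<one>\<^bsub>?Q\<^esub> \<and> (\<forall>h \<in> carrier H. \<phi> h C = C)"
  proof (rule p_group_fixed_vector[OF p M.a_factorgroup_is_comm_group])
    fix C assume "C \<in> carrier ?Q"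
    then obtain v where v: "v \<in> carrier R" "C = M +> v" by (auto simp: carQ)
    interpret Q: comm_group ?Q by (rule M.a_factorgroup_is_comm_group)
    interpret coset_hom: group_hom "add_monoid R" ?Q "\<lambda>a. M +> a"
      using M.a_r_coset_hom_A_Mod a_group
      by (simp add: group_hom_def group_hom_axioms_def Q.is_group)
    have "C [^]\<^bsub>?Q\<^esub> p = M +> ([p] \<cdot> v)"
      using coset_hom.hom_nat_pow[of v p] v by (simp add: add_pow_def)
    \<comment> \<open>The factor from \<open>M\<close> has to stand on the right, since
      \<open>M\<close> is only a left ideal.\<close>
    moreover have "[p] \<cdot> v = v \<otimes> ([p] \<cdot> \<one>)"
      using v(1) by (simp add: add_pow_rdistr)
    hence "[p] \<cdot> v \<in> M" using D(4) v(1) M(3) by simp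
    ultimately show "C [^]\<^bsub>?Q\<^esub> p = \<one>\<^bsub>?Q\<^esub>"
      using M.a_rcos_const oneQ by simp
    show "\<phi> \<one>\<^bsub>H\<^esub> C = C" using \<phi>[OF H.one_closed v(1)] v hom(2) by simp
    fix h k assume h: "h \<in> carrier H" and k: "k \<in> carrier H"
    show "\<phi> (h \<otimes>\<^bsub>H\<^esub> k) C = \<phi> h (\<phi> k C)"
      using h k v \<delta> \<delta>_mult by (simp add: \<phi> m_assoc)
  next
    fix h assume h: "h \<in> carrier H"
    show "\<phi> h \<in> hom ?Q ?Q"
    proof (rule homI)
      fix C assume C: "C \<in> carrier ?Q"
      then obtain v where v: "v \<in> carrier R" "C = M +> v" by (auto simp: carQ)
      thus "\<phi> h C \<in> carrier ?Q" using h \<delta> by (auto simp: \<phi> carQ)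
      fix E assume "E \<in> carrier ?Q"
      then obtain w where w: "w \<in> carrier R" "E = M +> w" by (auto simp: carQ)
      show "\<phi> h (C \<otimes>\<^bsub>?Q\<^esub> E) = \<phi> h C \<otimes>\<^bsub>?Q\<^esub> \<phi> h E"
        using v w h \<delta> by (simp add: M.a_rcos_sum \<phi> r_distr)
    qed
  next
    show "M +> \<one> \<in> carrier ?Q" by (auto simp: carQ)
    have "\<one> \<in> M +> \<one>" by (rule coset_self) simp
    moreover have "\<one> \<notin> M" using M(1,2) left_ideal_eq_carrier by blast
    ultimately show "M +> \<one> \<noteq> \<one>\<^bsub>?Q\<^esub>" using oneQ by auto
  qed
  then obtain v where v: "v \<in> carrier R" "M +> v \<noteq> M"
    "\<And>h. h \<in> carrier H \<Longrightarrow> \<phi> h (M +> v) = M +> v"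
    by (auto simp: carQ oneQ)
  have "v \<notin> M" using v(2) M.a_rcos_const by blast
  moreover have "\<delta> h \<otimes> v \<ominus> v \<in> M" if h: "h \<in> carrier H" for h
  proof -
    have "\<delta> h \<otimes> v \<in> M +> (\<delta> h \<otimes> v)"
      by (rule coset_self) (use \<delta>[OF h] v(1) in simp)
    hence "\<delta> h \<otimes> v \<in> M +> v" using \<phi>[OF h v(1)] v(3)[OF h] by simp
    then obtain m where m: "m \<in> M" "\<delta> h \<otimes> v = m \<oplus> v" by (auto simp: coset)
    hence "\<delta> h \<otimes> v \<ominus> v = m" using v(1) D(1) by (simp add: a_minus_def a_assoc r_neg subset_iff)
    thus ?thesis using m(1) by simp
  qed
  ultimately show ?thesis using v(1) by blast
qed

section \<open>Units and $W\Delta U$ rings under ring homomorphisms\<close>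

lemma (in ring_hom_ring) hom_Units:
  assumes "u \<in> Units R"
  shows "h u \<in> Units S"
proof -
  have "h (inv u) \<otimes>\<^bsub>S\<^esub> h u = \<one>\<^bsub>S\<^esub>" "h u \<otimes>\<^bsub>S\<^esub> h (inv u) = \<one>\<^bsub>S\<^esub>"
    using assms by (simp_all add: R.Units_closed flip: hom_mult)
  moreover have "h u \<in> carrier S" "h (inv u) \<in> carrier S"
    using assms by (simp_all add: R.Units_closed)
  ultimately show ?thesis unfolding Units_def by blast
qed

text \<open>Since 1 and -1 are units, adding elements of \<open>Delta R\<close> to them always gives
  units. Thus only one inclusion of the definition carries information.\<close>

lemma (in ring) WDU_iff:
  "WDU R \<longleftrightarrow> (\<forall>u \<in> Units R. u \<ominus> \<one> \<in> Delta R \<or> u \<oplus> \<one> \<in> Delta R)"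
proof -
  have m1: "\<ominus> \<one> \<in> Units R" by (simp add: Units_minus_one_closed)
  have c: "e \<oplus> d \<in> Units R" if "d \<in> Delta R" "e \<in> Units R" for d e
    using that by (simp add: Delta_def Units_closed a_comm[of e d])
  have mem: "u \<in> e <+ Delta R \<longleftrightarrow> u \<ominus> e \<in> Delta R"
    if u: "u \<in> carrier R" and e: "e \<in> carrier R" for u e
  proof
    assume "u \<in> e <+ Delta R"
    then obtain d where d: "d \<in> Delta R" "u = e \<oplus> d" by (auto simp: a_l_coset_def')
    moreover from d have "d \<in> carrier R" by (simp add: Delta_def)
    ultimately have "u \<ominus> e = d" using e by (simp add: a_minus_def a_assoc a_comm[of e d] r_neg)
    thus "u \<ominus> e \<in> Delta R" using d by simp
  next
    assume "u \<ominus> e \<in> Delta R"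
    moreover have "u = e \<oplus> (u \<ominus> e)" using u e by (simp add: a_minus_def a_lcomm[of e u] r_neg)
    ultimately show "u \<in> e <+ Delta R" by (auto simp: a_l_coset_def')
  qed
  have "(\<one> <+ Delta R) \<union> (\<ominus> \<one> <+ Delta R) \<subseteq> Units R"
    using c m1 by (auto simp: a_l_coset_def')
  moreover have "u \<in> (\<one> <+ Delta R) \<union> (\<ominus> \<one> <+ Delta R) \<longleftrightarrow> u \<ominus> \<one> \<in> Delta R \<or> u \<oplus> \<one> \<in> Delta R"
    if "u \<in> Units R" for u
    using mem[of u \<one>] mem[of u "\<ominus> \<one>"] that by (simp add: Units_closed a_minus_def)
  ultimately show ?thesis
    unfolding WDU_def by blast
qed

text \<open>An element \<open>d\<close> lies in \<open>Delta R\<close> as soon as \<open>i d\<close>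
  lies in \<open>Delta S\<close>: for a unit \<open>v\<close> the sum d + v is the image under
  \<open>e\<close> of the unit i d + i v.\<close>

lemma WDU_retract:
  assumes "ring_hom_ring R S i" "ring_hom_ring S R e" "\<And>r. r \<in> carrier R \<Longrightarrow> e (i r) = r"
    and W: "WDU S"
  shows "WDU R"
proof -
  interpret i: ring_hom_ring R S i by fact
  interpret e: ring_hom_ring S R e by fact
  have D: "d \<in> Delta R" if d: "d \<in> carrier R" "i d \<in> Delta S" for d
  proof -
    have "d \<oplus>\<^bsub>R\<^esub> v \<in> Units R" if v: "v \<in> Units R" for v
    proof -
      have "i d \<oplus>\<^bsub>S\<^esub> i v \<in> Units S" using d(2) i.hom_Units[OF v] by (simp add: Delta_def)
      from e.hom_Units[OF this] show ?thesis
        using d v assms(3) by (simp add: i.R.Units_closed)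
    qed
    thus ?thesis using d by (simp add: Delta_def)
  qed
  have "u \<ominus>\<^bsub>R\<^esub> \<one>\<^bsub>R\<^esub> \<in> Delta R \<or> u \<oplus>\<^bsub>R\<^esub> \<one>\<^bsub>R\<^esub> \<in> Delta R" if u: "u \<in> Units R" for u
  proof -
    have "i u \<ominus>\<^bsub>S\<^esub> \<one>\<^bsub>S\<^esub> \<in> Delta S \<or> i u \<oplus>\<^bsub>S\<^esub> \<one>\<^bsub>S\<^esub> \<in> Delta S"
      using W i.hom_Units[OF u] i.S.WDU_iff by blast
    moreover have "i (u \<ominus>\<^bsub>R\<^esub> \<one>\<^bsub>R\<^esub>) = i u \<ominus>\<^bsub>S\<^esub> \<one>\<^bsub>S\<^esub>" "i (u \<oplus>\<^bsub>R\<^esub> \<one>\<^bsub>R\<^esub>) = i u \<oplus>\<^bsub>S\<^esub> \<one>\<^bsub>S\<^esub>"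
      using u by (simp_all add: a_minus_def i.R.Units_closed)
    ultimately show ?thesis using D u by (metis i.R.Units_closed i.R.minus_closed i.R.add.m_closed i.R.one_closed)
  qed
  thus ?thesis using i.R.WDU_iff by blast
qed

text \<open>If \<open>h d\<close> lies in \<open>Delta S\<close> and \<open>v\<close> is a unit,
  then d + v maps to a unit and hence is one. So membership in Delta is reflected, and with it the
  form of the units.\<close>

lemma (in ring_hom_ring) WDU_reflect_Units:
  assumes W: "WDU S" and reflect: "\<And>x. x \<in> carrier R \<Longrightarrow> h x \<in> Units S \<Longrightarrow> x \<in> Units R"
  shows "WDU R"
proof -
  have D: "d \<in> Delta R" if d: "d \<in> carrier R" "h d \<in> Delta S" for d
  proof -
    have "d \<oplus> v \<in> Units R" if v: "v \<in> Units R" for v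
      using d hom_Units[OF v] v by (intro reflect) (auto simp: Delta_def)
    thus ?thesis using d by (simp add: Delta_def)
  qed
  have "u \<ominus> \<one> \<in> Delta R \<or> u \<oplus> \<one> \<in> Delta R" if u: "u \<in> Units R" for u
  proof -
    have "h u \<ominus>\<^bsub>S\<^esub> \<one>\<^bsub>S\<^esub> \<in> Delta S \<or> h u \<oplus>\<^bsub>S\<^esub> \<one>\<^bsub>S\<^esub> \<in> Delta S"
      using W hom_Units[OF u] S.WDU_iff by blast
    moreover have "h (u \<ominus> \<one>) = h u \<ominus>\<^bsub>S\<^esub> \<one>\<^bsub>S\<^esub>" "h (u \<oplus> \<one>) = h u \<oplus>\<^bsub>S\<^esub> \<one>\<^bsub>S\<^esub>"
      using u by (simp_all add: a_minus_def R.Units_closed)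
    ultimately show ?thesis using D u by (metis R.Units_closed R.minus_closed R.add.m_closed R.one_closed)
  qed
  thus ?thesis using R.WDU_iff by blast
qed

section \<open>The augmentation\<close>

text \<open>The monomial r g. For g the identity these are the constants, for r = 1 the group
  elements inside the group ring.\<close>

definition single :: "('r, 'm) ring_scheme \<Rightarrow> 'g \<Rightarrow> 'r \<Rightarrow> 'g \<Rightarrow> 'r"
  where "single R g r = (\<lambda>x. if x = g then r else \<zero>\<^bsub>R\<^esub>)"

text \<open>It does not mention the group, so its value is the same in the group ring of a
  subgroup.\<close>

definition augmentation :: "('r, 'm) ring_scheme \<Rightarrow> ('g \<Rightarrow> 'r) \<Rightarrow> 'r"
  where "augmentation R f = (\<Oplus>\<^bsub>R\<^esub>x \<in> {x. f x \<noteq> \<zero>\<^bsub>R\<^esub>}. f x)"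

locale ring_and_group = R: ring R + G: group G
  for R :: "('r, 'm) ring_scheme" and G :: "('g, 'n) monoid_scheme"
begin

abbreviation "RG \<equiv> group_ring R G"

sublocale RG: ring RG
  by (intro ring_group_ring R.ring_axioms G.group_axioms)

abbreviation "\<epsilon> \<equiv> augmentation R"

lemma carrier_RG: "f \<in> carrier RG \<longleftrightarrow> (\<forall>x \<in> carrier G. f x \<in> carrier R) \<and>
    (\<forall>x. x \<notin> carrier G \<longrightarrow> f x = \<zero>\<^bsub>R\<^esub>) \<and> finite {x. f x \<noteq> \<zero>\<^bsub>R\<^esub>}"
  by (simp add: group_ring_def)

lemma apply_closed: "f \<in> carrier RG \<Longrightarrow> f x \<in> carrier R"
  by (cases "x \<in> carrier G") (auto simp: carrier_RG)

lemma add_RG: "f \<oplus>\<^bsub>RG\<^esub> h = (\<lambda>x. f x \<oplus>\<^bsub>R\<^esub> h x)"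
  by (simp add: group_ring_def)

lemma zero_RG: "\<zero>\<^bsub>RG\<^esub> = (\<lambda>x. \<zero>\<^bsub>R\<^esub>)"
  by (simp add: group_ring_def)

lemma one_RG: "\<one>\<^bsub>RG\<^esub> = single R \<one>\<^bsub>G\<^esub> \<one>\<^bsub>R\<^esub>"
  by (simp add: group_ring_def single_def)

lemma single_closed:
  assumes "g \<in> carrier G" "r \<in> carrier R"
  shows "single R g r \<in> carrier RG"
proof -
  have "{x. single R g r x \<noteq> \<zero>\<^bsub>R\<^esub>} \<subseteq> {g}" by (auto simp: single_def)
  hence "finite {x. single R g r x \<noteq> \<zero>\<^bsub>R\<^esub>}" by (rule finite_subset) simp
  thus ?thesis using assms by (auto simp: carrier_RG) (auto simp: single_def)
qed

lemma single_mult_apply: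
  assumes "g \<in> carrier G" "r \<in> carrier R" "f \<in> carrier RG" "x \<in> carrier G"
  shows "(single R g r \<otimes>\<^bsub>RG\<^esub> f) x = r \<otimes>\<^bsub>R\<^esub> f (inv\<^bsub>G\<^esub> g \<otimes>\<^bsub>G\<^esub> x)"
proof -
  have c: "f (inv\<^bsub>G\<^esub> g \<otimes>\<^bsub>G\<^esub> x) \<in> carrier R"
    by (rule apply_closed[OF assms(3)])
  have mult: "(single R g r \<otimes>\<^bsub>RG\<^esub> f) x =
    (\<Oplus>\<^bsub>R\<^esub>y \<in> {y. single R g r y \<noteq> \<zero>\<^bsub>R\<^esub>}. single R g r y \<otimes>\<^bsub>R\<^esub> f (inv\<^bsub>G\<^esub> y \<otimes>\<^bsub>G\<^esub> x))"
    using assms(4) by (simp add: group_ring_def)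
  show ?thesis
  \<comment> \<open>The convolution runs over the support of the left factor, which for r = 0 is
    empty instead of {g}.\<close>
  proof (cases "r = \<zero>\<^bsub>R\<^esub>")
    case True
    hence "{y. single R g r y \<noteq> \<zero>\<^bsub>R\<^esub>} = {}" by (auto simp: single_def)
    thus ?thesis unfolding mult using True c by simp
  next
    case False
    hence "{y. single R g r y \<noteq> \<zero>\<^bsub>R\<^esub>} = {g}" by (auto simp: single_def)
    thus ?thesis unfolding mult using assms(2) c by (simp add: single_def)
  qed
qed

lemma single_mult:
  assumes "g \<in> carrier G" "r \<in> carrier R" "h \<in> carrier G" "s \<in> carrier R"
  shows "single R g r \<otimes>\<^bsub>RG\<^esub> single R h s = single R (g \<otimes>\<^bsub>G\<^esub> h) (r \<otimes>\<^bsub>R\<^esub> s)"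
proof
  fix x
  show "(single R g r \<otimes>\<^bsub>RG\<^esub> single R h s) x = single R (g \<otimes>\<^bsub>G\<^esub> h) (r \<otimes>\<^bsub>R\<^esub> s) x"
  proof (cases "x \<in> carrier G")
    case True
    hence "inv\<^bsub>G\<^esub> g \<otimes>\<^bsub>G\<^esub> x = h \<longleftrightarrow> x = g \<otimes>\<^bsub>G\<^esub> h"
      using assms by (metis G.inv_solve_left)
    thus ?thesis
      using True assms by (simp add: single_mult_apply single_closed) (simp add: single_def)
  next
    case False
    moreover have "g \<otimes>\<^bsub>G\<^esub> h \<in> carrier G" using assms by simp
    ultimately show ?thesis by (auto simp: group_ring_def single_def)
  qed
qed

lemma single_add:
  "r \<in> carrier R \<Longrightarrow> s \<in> carrier R \<Longrightarrow>
    single R g (r \<oplus>\<^bsub>R\<^esub> s) = single R g r \<oplus>\<^bsub>RG\<^esub> single R g s"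
  by (auto simp: single_def add_RG)

text \<open>An induction principle for the group ring: additive conditions need checking only on
  monomials. The proof splits off one coefficient at a time, by induction on a finite set containing
  the support.\<close>

lemma RG_spanned_by_single:
  assumes "\<zero>\<^bsub>RG\<^esub> \<in> N" "\<And>f h. f \<in> N \<Longrightarrow> h \<in> N \<Longrightarrow> f \<oplus>\<^bsub>RG\<^esub> h \<in> N"
    and "\<And>g r. g \<in> carrier G \<Longrightarrow> r \<in> carrier R \<Longrightarrow> single R g r \<in> N"
  shows "carrier RG \<subseteq> N"
proof -
  have "f \<in> N" if "finite F" "f \<in> carrier RG" "{x. f x \<noteq> \<zero>\<^bsub>R\<^esub>} \<subseteq> F" for f F
    using that
  proof (induction F arbitrary: f rule: finite_induct)
    case empty
    hence "f = \<zero>\<^bsub>RG\<^esub>" by (auto simp: zero_RG)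
    thus ?case using assms(1) by simp
  next
    case (insert g F)
    let ?f = "f(g := \<zero>\<^bsub>R\<^esub>)"
    have "{x. ?f x \<noteq> \<zero>\<^bsub>R\<^esub>} \<subseteq> {x. f x \<noteq> \<zero>\<^bsub>R\<^esub>}" by auto
    hence "finite {x. ?f x \<noteq> \<zero>\<^bsub>R\<^esub>}"
      by (rule finite_subset) (use insert.prems in \<open>simp add: carrier_RG\<close>)
    hence "?f \<in> carrier RG" using insert.prems by (simp add: carrier_RG)
    have f: "?f \<in> N"
    proof (rule insert.IH)
      show "?f \<in> carrier RG" by fact
      show "{x. ?f x \<noteq> \<zero>\<^bsub>R\<^esub>} \<subseteq> F" using insert.prems by auto
    qed
    show ?case
    proof (cases "g \<in> carrier G")
      case True
      have "f = single R g (f g) \<oplus>\<^bsub>RG\<^esub> ?f"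
        using insert.prems(1) by (auto simp: add_RG single_def apply_closed)
      thus ?thesis using f assms(2,3) True insert.prems(1) apply_closed by metis
    next
      \<comment> \<open>\<open>F\<close> is an arbitrary finite set and may contain points outside
        the group, where the coefficient is zero.\<close>
      case False
      hence "f g = \<zero>\<^bsub>R\<^esub>" using insert.prems(1) by (simp add: carrier_RG)
      hence "?f = f" by auto
      thus ?thesis using f by simp
    qed
  qed
  thus ?thesis by (auto simp: carrier_RG)
qed

section \<open>The augmentation as a ring homomorphism\<close>

lemma augmentation_eq:
  assumes "f \<in> carrier RG" "finite A" "{x. f x \<noteq> \<zero>\<^bsub>R\<^esub>} \<subseteq> A"
  shows "\<epsilon> f = (\<Oplus>\<^bsub>R\<^esub>x \<in> A. f x)"
  unfolding augmentation_def
  by (rule R.add.finprod_mono_neutral_cong_left) (use assms apply_closed in auto)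

lemma augmentation_closed: "f \<in> carrier RG \<Longrightarrow> \<epsilon> f \<in> carrier R"
  by (simp add: augmentation_def apply_closed)

lemma augmentation_add:
  assumes f: "f \<in> carrier RG" and h: "h \<in> carrier RG"
  shows "\<epsilon> (f \<oplus>\<^bsub>RG\<^esub> h) = \<epsilon> f \<oplus>\<^bsub>R\<^esub> \<epsilon> h"
proof -
  let ?A = "{x. f x \<noteq> \<zero>\<^bsub>R\<^esub>} \<union> {x. h x \<noteq> \<zero>\<^bsub>R\<^esub>}"
  have A: "finite ?A" using f h by (simp add: carrier_RG)
  have s: "{x. (f \<oplus>\<^bsub>RG\<^esub> h) x \<noteq> \<zero>\<^bsub>R\<^esub>} \<subseteq> ?A" by (auto simp: add_RG)
  have "\<epsilon> (f \<oplus>\<^bsub>RG\<^esub> h) = (\<Oplus>\<^bsub>R\<^esub>x \<in> ?A. f x \<oplus>\<^bsub>R\<^esub> h x)"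
    using augmentation_eq[OF RG.a_closed[OF f h] A s] by (simp add: add_RG)
  also have "\<dots> = (\<Oplus>\<^bsub>R\<^esub>x \<in> ?A. f x) \<oplus>\<^bsub>R\<^esub> (\<Oplus>\<^bsub>R\<^esub>x \<in> ?A. h x)"
    by (rule R.finsum_addf) (use f h apply_closed in auto)
  also have "\<dots> = \<epsilon> f \<oplus>\<^bsub>R\<^esub> \<epsilon> h"
    using augmentation_eq[OF f A] augmentation_eq[OF h A] by simp
  finally show ?thesis .
qed

lemma augmentation_single:
  assumes "g \<in> carrier G" "r \<in> carrier R"
  shows "\<epsilon> (single R g r) = r"
proof -
  have "\<epsilon> (single R g r) = (\<Oplus>\<^bsub>R\<^esub>x \<in> {g}. single R g r x)"
    by (rule augmentation_eq[OF single_closed[OF assms]]) (auto simp: single_def)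
  thus ?thesis using assms by (simp add: single_def)
qed

lemma augmentation_zero: "\<epsilon> \<zero>\<^bsub>RG\<^esub> = \<zero>\<^bsub>R\<^esub>"
  by (simp add: augmentation_def zero_RG)

text \<open>Both sides are additive in each factor, so the claim reduces to monomials twice:
  \<open>?A\<close> treats the first factor and \<open>?B\<close> the second.\<close>

lemma augmentation_mult:
  assumes "f \<in> carrier RG" "h \<in> carrier RG"
  shows "\<epsilon> (f \<otimes>\<^bsub>RG\<^esub> h) = \<epsilon> f \<otimes>\<^bsub>R\<^esub> \<epsilon> h"
proof -
  let ?A = "{f \<in> carrier RG. \<forall>h \<in> carrier RG. \<epsilon> (f \<otimes>\<^bsub>RG\<^esub> h) = \<epsilon> f \<otimes>\<^bsub>R\<^esub> \<epsilon> h}"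
  have "single R g r \<in> ?A" if gr: "g \<in> carrier G" "r \<in> carrier R" for g r
  proof -
    let ?B = "{h \<in> carrier RG. \<epsilon> (single R g r \<otimes>\<^bsub>RG\<^esub> h) = r \<otimes>\<^bsub>R\<^esub> \<epsilon> h}"
    have "carrier RG \<subseteq> ?B"
    proof (rule RG_spanned_by_single)
      show "\<zero>\<^bsub>RG\<^esub> \<in> ?B" using gr by (simp add: augmentation_zero single_closed)
      show "h \<oplus>\<^bsub>RG\<^esub> k \<in> ?B" if "h \<in> ?B" "k \<in> ?B" for h k
        using that gr by (simp add: RG.r_distr R.r_distr augmentation_add augmentation_closed single_closed)
      show "single R h s \<in> ?B" if "h \<in> carrier G" "s \<in> carrier R" for h s
        using that gr by (simp add: single_closed single_mult augmentation_single)
    qed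
    thus ?thesis using gr by (auto simp: single_closed augmentation_single)
  qed
  moreover have "\<zero>\<^bsub>RG\<^esub> \<in> ?A" by (simp add: augmentation_zero augmentation_closed)
  moreover have "f \<oplus>\<^bsub>RG\<^esub> h \<in> ?A" if "f \<in> ?A" "h \<in> ?A" for f h
    using that by (simp add: RG.l_distr R.l_distr augmentation_add augmentation_closed)
  ultimately have "carrier RG \<subseteq> ?A" by (intro RG_spanned_by_single)
  thus ?thesis using assms by blast
qed

sublocale aug: ring_hom_ring RG R \<epsilon>
  by (rule ring_hom_ringI)
     (simp_all add: RG.ring_axioms R.ring_axioms augmentation_closed augmentation_mult
       augmentation_add one_RG augmentation_single)

sublocale const: ring_hom_ring R RG "single R \<one>\<^bsub>G\<^esub>"
  by (rule ring_hom_ringI)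
     (simp_all add: RG.ring_axioms R.ring_axioms single_closed single_mult single_add one_RG)

end

section \<open>Units and the augmentation\<close>

context ring_and_group
begin

lemma subring_const: "subring (single R \<one>\<^bsub>G\<^esub> ` carrier R) RG"
  using const.img_is_subring[OF R.carrier_is_subring] .

lemma const_mult_single:
  assumes "g \<in> carrier G" "r \<in> carrier R"
  shows "single R \<one>\<^bsub>G\<^esub> r \<otimes>\<^bsub>RG\<^esub> single R g \<one>\<^bsub>R\<^esub> = single R g r"
  using assms by (simp add: single_mult)

text \<open>A central coefficient commutes with every monomial, because constants commute with group
  elements.\<close>

lemma const_central:
  assumes q: "q \<in> carrier R" "\<And>r. r \<in> carrier R \<Longrightarrow> q \<otimes>\<^bsub>R\<^esub> r = r \<otimes>\<^bsub>R\<^esub> q"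
    and f: "f \<in> carrier RG"
  shows "single R \<one>\<^bsub>G\<^esub> q \<otimes>\<^bsub>RG\<^esub> f = f \<otimes>\<^bsub>RG\<^esub> single R \<one>\<^bsub>G\<^esub> q"
proof -
  let ?q = "single R \<one>\<^bsub>G\<^esub> q"
  let ?N = "{f \<in> carrier RG. ?q \<otimes>\<^bsub>RG\<^esub> f = f \<otimes>\<^bsub>RG\<^esub> ?q}"
  have qC: "?q \<in> carrier RG" using q(1) by (simp add: single_closed)
  have "carrier RG \<subseteq> ?N"
  proof (rule RG_spanned_by_single)
    show "\<zero>\<^bsub>RG\<^esub> \<in> ?N" using qC by simp
    show "f \<oplus>\<^bsub>RG\<^esub> h \<in> ?N" if "f \<in> ?N" "h \<in> ?N" for f h
      using that qC by (simp add: RG.l_distr RG.r_distr)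
    show "single R g r \<in> ?N" if "g \<in> carrier G" "r \<in> carrier R" for g r
      using that q by (simp add: single_closed single_mult)
  qed
  thus ?thesis using f by blast
qed

text \<open>If q were not in \<open>M\<close>, then M + RG q = RG by maximality, and this is M + q
  RG as q is central. Since \<open>G\<close> is finite, RG is finitely generated over the constants,
  so Nakayama's lemma would give M = RG.\<close>

lemma central_jacobson_radical_in_maximal:
  assumes fin: "finite (carrier G)"
    and q: "q \<in> jacobson_radical R" "\<And>r. r \<in> carrier R \<Longrightarrow> q \<otimes>\<^bsub>R\<^esub> r = r \<otimes>\<^bsub>R\<^esub> q"
    and M: "maximal_left_ideal M RG"
  shows "single R \<one>\<^bsub>G\<^esub> q \<in> M"
proof (rule ccontr)
  let ?q = "single R \<one>\<^bsub>G\<^esub> q" and ?T = "single R \<one>\<^bsub>G\<^esub> ` carrier R"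
  assume "?q \<notin> M"
  have qR: "q \<in> carrier R" using q(1) by (simp add: jacobson_radical_def)
  have qC: "?q \<in> carrier RG" using qR by (simp add: single_closed)
  have lM: "left_ideal M RG" "M \<noteq> carrier RG"
    and max: "\<And>K. left_ideal K RG \<Longrightarrow> M \<subseteq> K \<Longrightarrow> K = M \<or> K = carrier RG"
    using M by (simp_all add: maximal_left_ideal_def)
  have sM: "submod (carrier RG) M RG" using lM(1) by (simp add: left_ideal_iff_submod)
  let ?N = "{i \<oplus>\<^bsub>RG\<^esub> f \<otimes>\<^bsub>RG\<^esub> ?q | i f. i \<in> M \<and> f \<in> carrier RG}"
  note N = RG.submod_add_principal[OF RG.carrier_is_subring sM qC]
  have "?N = carrier RG"
    using max[of ?N] N \<open>?q \<notin> M\<close> by (auto simp only: left_ideal_iff_submod)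
  \<comment> \<open>Nakayama is used over the constants \<open>?T\<close>: for these the left
    inverses of 1 - t q come from the Jacobson radical of \<open>R\<close>.\<close>
  have "M = carrier RG"
  proof (rule RG.nakayama[OF subring_const])
    show "?q \<in> ?T" using qR by blast
    show "?q \<otimes>\<^bsub>RG\<^esub> f = f \<otimes>\<^bsub>RG\<^esub> ?q" if "f \<in> carrier RG" for f
      using const_central[OF qR q(2) that] .
    show "submod ?T M RG"
      using sM single_closed by (auto simp: submod_def)
    show "finite ((\<lambda>g. single R g \<one>\<^bsub>R\<^esub>) ` carrier G)" using fin by simp
    show "(\<lambda>g. single R g \<one>\<^bsub>R\<^esub>) ` carrier G \<subseteq> carrier RG"
      by (auto simp: single_closed)
    show "\<exists>s \<in> ?T. s \<otimes>\<^bsub>RG\<^esub> (\<one>\<^bsub>RG\<^esub> \<ominus>\<^bsub>RG\<^esub> t \<otimes>\<^bsub>RG\<^esub> ?q) = \<one>\<^bsub>RG\<^esub>" if t: "t \<in> ?T" for t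
    proof -
      obtain r where r: "r \<in> carrier R" "t = single R \<one>\<^bsub>G\<^esub> r" using t by blast
      obtain s where s: "s \<in> carrier R" "s \<otimes>\<^bsub>R\<^esub> (\<one>\<^bsub>R\<^esub> \<ominus>\<^bsub>R\<^esub> r \<otimes>\<^bsub>R\<^esub> q) = \<one>\<^bsub>R\<^esub>"
        using R.jacobson_radical_left_inverse[OF q(1) r(1)] by blast
      have "single R \<one>\<^bsub>G\<^esub> (s \<otimes>\<^bsub>R\<^esub> (\<one>\<^bsub>R\<^esub> \<ominus>\<^bsub>R\<^esub> r \<otimes>\<^bsub>R\<^esub> q)) =
          single R \<one>\<^bsub>G\<^esub> s \<otimes>\<^bsub>RG\<^esub> (\<one>\<^bsub>RG\<^esub> \<ominus>\<^bsub>RG\<^esub> t \<otimes>\<^bsub>RG\<^esub> ?q)"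
        using r s(1) qR by (simp add: a_minus_def)
      hence "single R \<one>\<^bsub>G\<^esub> s \<otimes>\<^bsub>RG\<^esub> (\<one>\<^bsub>RG\<^esub> \<ominus>\<^bsub>RG\<^esub> t \<otimes>\<^bsub>RG\<^esub> ?q) = \<one>\<^bsub>RG\<^esub>"
        using s(2) by simp
      thus ?thesis using s(1) by blast
    qed
    show "K = carrier RG"
      if K: "submod ?T K RG" "M \<subseteq> K" "(\<lambda>g. single R g \<one>\<^bsub>R\<^esub>) ` carrier G \<subseteq> K" for K
    proof -
      note D = RG.submodD[OF K(1)]
      have "carrier RG \<subseteq> K"
      proof (rule RG_spanned_by_single)
        fix g r assume "g \<in> carrier G" "r \<in> carrier R"
        thus "single R g r \<in> K"
          using D(6)[of "single R \<one>\<^bsub>G\<^esub> r" "single R g \<one>\<^bsub>R\<^esub>"] K(3) const_mult_single by auto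
      qed (use D(2,3) in auto)
      thus ?thesis using D(1) by blast
    qed
    show "\<exists>i\<in>M. \<exists>w\<in>carrier RG. v = i \<oplus>\<^bsub>RG\<^esub> ?q \<otimes>\<^bsub>RG\<^esub> w" if "v \<in> carrier RG" for v
    proof -
      have "v \<in> ?N" using that \<open>?N = carrier RG\<close> by simp
      then obtain i f where "i \<in> M" "f \<in> carrier RG" "v = i \<oplus>\<^bsub>RG\<^esub> f \<otimes>\<^bsub>RG\<^esub> ?q"
        by blast
      thus ?thesis using const_central[OF qR q(2)] by metis
    qed
  qed
  thus False using lM(2) by blast
qed

lemma nat_const_eq:
  "single R \<one>\<^bsub>G\<^esub> ([n] \<cdot>\<^bsub>R\<^esub> \<one>\<^bsub>R\<^esub>) = [n] \<cdot>\<^bsub>RG\<^esub> \<one>\<^bsub>RG\<^esub>" for n :: nat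
  by (induction n) simp_all

section \<open>Elements of augmentation one over a finite p-group\<close>

text \<open>Otherwise \<open>x\<close> lies in a maximal left ideal \<open>M\<close>. The group acts
  trivially on the simple module RG/M, so every element is congruent to its augmentation modulo
  \<open>M\<close>, and \<open>x\<close> to 1.\<close>

lemma left_inverse_if_augmentation_one:
  assumes p: "Factorial_Ring.prime p" "p_group p G" "finite (carrier G)"
    and q: "[p] \<cdot>\<^bsub>R\<^esub> \<one>\<^bsub>R\<^esub> \<in> jacobson_radical R"
    and x: "x \<in> carrier RG" "\<epsilon> x = \<one>\<^bsub>R\<^esub>"
  shows "\<exists>y \<in> carrier RG. y \<otimes>\<^bsub>RG\<^esub> x = \<one>\<^bsub>RG\<^esub>"
proof (rule ccontr)
  assume no: "\<not> ?thesis"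
  let ?I = "{i \<oplus>\<^bsub>RG\<^esub> f \<otimes>\<^bsub>RG\<^esub> x | i f. i \<in> {\<zero>\<^bsub>RG\<^esub>} \<and> f \<in> carrier RG}"
  have s0: "submod (carrier RG) {\<zero>\<^bsub>RG\<^esub>} RG"
    using RG.left_ideal_zero by (simp add: left_ideal_iff_submod)
  note I = RG.submod_add_principal[OF RG.carrier_is_subring s0 x(1)]
  have "\<one>\<^bsub>RG\<^esub> \<notin> ?I" using no x(1) by auto
  hence "?I \<noteq> carrier RG" using RG.one_closed by blast
  then obtain M where M: "maximal_left_ideal M RG" "?I \<subseteq> M"
    using RG.exists_maximal_left_ideal[of ?I] I(1) by (auto simp only: left_ideal_iff_submod)
  have lM: "left_ideal M RG" "M \<noteq> carrier RG"
    and max: "\<And>K. left_ideal K RG \<Longrightarrow> M \<subseteq> K \<Longrightarrow> K = M \<or> K = carrier RG"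
    using M(1) by (simp_all add: maximal_left_ideal_def)
  note D = RG.submodD[OF lM(1)[unfolded left_ideal_iff_submod]]
  have MC: "m \<in> carrier RG" if "m \<in> M" for m using D(1) that by blast
  define \<delta> :: "'g \<Rightarrow> 'g \<Rightarrow> 'r" where "\<delta> g = single R g \<one>\<^bsub>R\<^esub>" for g
  have \<delta>: "\<delta> g \<in> carrier RG" if "g \<in> carrier G" for g
    using that by (simp add: \<delta>_def single_closed)
  have "single R \<one>\<^bsub>G\<^esub> ([p] \<cdot>\<^bsub>R\<^esub> \<one>\<^bsub>R\<^esub>) \<in> M"
    using p(3) q _ M(1)
    by (rule central_jacobson_radical_in_maximal) (simp add: R.add_pow_ldistr R.add_pow_rdistr)
  hence pM: "[p] \<cdot>\<^bsub>RG\<^esub> \<one>\<^bsub>RG\<^esub> \<in> M" by (simp only: nat_const_eq)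
  have \<delta>_hom: "\<delta> \<in> hom G RG"
    by (rule homI) (simp_all add: \<delta>_def single_closed single_mult)
  have \<delta>_one: "\<delta> \<one>\<^bsub>G\<^esub> = \<one>\<^bsub>RG\<^esub>" by (simp add: \<delta>_def)
  obtain v where v: "v \<in> carrier RG" "v \<notin> M"
    "\<And>g. g \<in> carrier G \<Longrightarrow> \<delta> g \<otimes>\<^bsub>RG\<^esub> v \<ominus>\<^bsub>RG\<^esub> v \<in> M"
    using RG.exists_fixed_mod_left_ideal[OF p lM pM \<delta>_hom \<delta>_one] by blast
  \<comment> \<open>The preimage in RG of the fixed vectors of RG/M. It turns out to be a left ideal
    strictly above \<open>M\<close>, hence everything.\<close>
  define K where "K = {v \<in> carrier RG. \<forall>g \<in> carrier G. \<delta> g \<otimes>\<^bsub>RG\<^esub> v \<ominus>\<^bsub>RG\<^esub> v \<in> M}"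
  have K_add: "a \<oplus>\<^bsub>RG\<^esub> b \<in> K" if "a \<in> K" "b \<in> K" for a b
  proof -
    have "\<delta> g \<otimes>\<^bsub>RG\<^esub> (a \<oplus>\<^bsub>RG\<^esub> b) \<ominus>\<^bsub>RG\<^esub> (a \<oplus>\<^bsub>RG\<^esub> b) \<in> M" if g: "g \<in> carrier G" for g
    proof -
      have ab: "a \<in> carrier RG" "b \<in> carrier RG" using \<open>a \<in> K\<close> \<open>b \<in> K\<close> by (auto simp: K_def)
      have "\<delta> g \<otimes>\<^bsub>RG\<^esub> (a \<oplus>\<^bsub>RG\<^esub> b) \<ominus>\<^bsub>RG\<^esub> (a \<oplus>\<^bsub>RG\<^esub> b) =
          (\<delta> g \<otimes>\<^bsub>RG\<^esub> a \<ominus>\<^bsub>RG\<^esub> a) \<oplus>\<^bsub>RG\<^esub> (\<delta> g \<otimes>\<^bsub>RG\<^esub> b \<ominus>\<^bsub>RG\<^esub> b)"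
        using ab \<delta>[OF g] by (simp add: RG.r_distr a_minus_def RG.minus_add RG.a_ac)
      thus ?thesis using D(3) \<open>a \<in> K\<close> \<open>b \<in> K\<close> g by (simp add: K_def)
    qed
    thus ?thesis using that by (simp add: K_def)
  qed
  have K_single: "single R k r \<otimes>\<^bsub>RG\<^esub> a \<in> K"
    if k: "k \<in> carrier G" and r: "r \<in> carrier R" and a: "a \<in> K" for k r a
  proof -
    have aC: "a \<in> carrier RG" using a by (simp add: K_def)
    have sC: "single R k r \<in> carrier RG" using k r by (simp add: single_closed)
    have "\<delta> g \<otimes>\<^bsub>RG\<^esub> (single R k r \<otimes>\<^bsub>RG\<^esub> a) \<ominus>\<^bsub>RG\<^esub> single R k r \<otimes>\<^bsub>RG\<^esub> a \<in> M"
      if g: "g \<in> carrier G" for g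
    proof -
      let ?r = "single R \<one>\<^bsub>G\<^esub> r"
      have rC: "?r \<in> carrier RG" using r by (simp add: single_closed)
      \<comment> \<open>As \<open>a\<close> is fixed modulo \<open>M\<close> by both g k and k, the
        difference g k a - k a lies in \<open>M\<close>. The constant r commutes with group elements
        and can be pulled out to the left.\<close>
      let ?d = "(\<delta> (g \<otimes>\<^bsub>G\<^esub> k) \<otimes>\<^bsub>RG\<^esub> a \<ominus>\<^bsub>RG\<^esub> a) \<ominus>\<^bsub>RG\<^esub> (\<delta> k \<otimes>\<^bsub>RG\<^esub> a \<ominus>\<^bsub>RG\<^esub> a)"
      have C: "\<delta> g \<in> carrier RG" "\<delta> k \<in> carrier RG" "\<delta> (g \<otimes>\<^bsub>G\<^esub> k) \<in> carrier RG"
        using g k \<delta> by auto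
      have cancel: "?d = \<delta> (g \<otimes>\<^bsub>G\<^esub> k) \<otimes>\<^bsub>RG\<^esub> a \<ominus>\<^bsub>RG\<^esub> \<delta> k \<otimes>\<^bsub>RG\<^esub> a"
        using C aC by (simp add: a_minus_def RG.minus_add RG.a_ac RG.r_neg2)
      have e1: "\<delta> g \<otimes>\<^bsub>RG\<^esub> (single R k r \<otimes>\<^bsub>RG\<^esub> a) = ?r \<otimes>\<^bsub>RG\<^esub> (\<delta> (g \<otimes>\<^bsub>G\<^esub> k) \<otimes>\<^bsub>RG\<^esub> a)"
        using C aC sC rC g k r by (simp add: RG.m_assoc[symmetric] \<delta>_def single_mult)
      have e2: "single R k r \<otimes>\<^bsub>RG\<^esub> a = ?r \<otimes>\<^bsub>RG\<^esub> (\<delta> k \<otimes>\<^bsub>RG\<^esub> a)"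
        using C aC sC rC g k r by (simp add: RG.m_assoc[symmetric] \<delta>_def single_mult)
      have "?d \<in> M" using a g k D(5) by (simp add: K_def)
      hence "?r \<otimes>\<^bsub>RG\<^esub> ?d \<in> M" using D(6) rC by blast
      moreover have "?r \<otimes>\<^bsub>RG\<^esub> ?d =
        ?r \<otimes>\<^bsub>RG\<^esub> (\<delta> (g \<otimes>\<^bsub>G\<^esub> k) \<otimes>\<^bsub>RG\<^esub> a) \<ominus>\<^bsub>RG\<^esub> ?r \<otimes>\<^bsub>RG\<^esub> (\<delta> k \<otimes>\<^bsub>RG\<^esub> a)"
        unfolding cancel using C aC rC by (simp add: a_minus_def RG.r_distr RG.r_minus)
      ultimately show ?thesis using e1 e2 by simp
    qed
    thus ?thesis using sC aC by (simp add: K_def)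
  qed
  have K_zero: "\<zero>\<^bsub>RG\<^esub> \<in> K" using D(2) \<delta> by (simp add: K_def a_minus_def)
  have K_mult: "f \<otimes>\<^bsub>RG\<^esub> a \<in> K" if f: "f \<in> carrier RG" and a: "a \<in> K" for f a
  proof -
    have aC: "a \<in> carrier RG" using a by (simp add: K_def)
    have "carrier RG \<subseteq> {f \<in> carrier RG. f \<otimes>\<^bsub>RG\<^esub> a \<in> K}"
      by (rule RG_spanned_by_single)
         (use aC a K_zero K_add K_single in \<open>auto simp: RG.l_distr single_closed\<close>)
    thus ?thesis using f by blast
  qed
  have "left_ideal K RG"
    unfolding left_ideal_def
  proof (intro conjI RG.additive_subgroupI')
    show "\<ominus>\<^bsub>RG\<^esub> a \<in> K" if "a \<in> K" for a
    proof -
      have "a \<in> carrier RG" using that by (simp add: K_def)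
      hence "(\<ominus>\<^bsub>RG\<^esub> \<one>\<^bsub>RG\<^esub>) \<otimes>\<^bsub>RG\<^esub> a = \<ominus>\<^bsub>RG\<^esub> a" by (simp add: RG.l_minus)
      thus ?thesis using K_mult[of "\<ominus>\<^bsub>RG\<^esub> \<one>\<^bsub>RG\<^esub>" a] that by simp
    qed
  qed (use K_zero K_add K_mult in \<open>auto simp: K_def\<close>)
  moreover have "M \<subseteq> K"
    using MC D(5,6) \<delta> by (auto simp: K_def)
  moreover have "v \<in> K" using v by (simp add: K_def)
  ultimately have "K = carrier RG" using max v(2) by blast
  hence "\<one>\<^bsub>RG\<^esub> \<in> K" by simp
  hence triv: "\<delta> g \<ominus>\<^bsub>RG\<^esub> \<one>\<^bsub>RG\<^esub> \<in> M" if "g \<in> carrier G" for g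
    using that \<delta> by (simp add: K_def)
  \<comment> \<open>For a monomial the difference is r g - r = r (g - 1), which lies in
    \<open>M\<close> by \<open>triv\<close>.\<close>
  have "carrier RG \<subseteq> {f \<in> carrier RG. f \<ominus>\<^bsub>RG\<^esub> single R \<one>\<^bsub>G\<^esub> (\<epsilon> f) \<in> M}"
  proof (rule RG_spanned_by_single)
    show "\<zero>\<^bsub>RG\<^esub> \<in> {f \<in> carrier RG. f \<ominus>\<^bsub>RG\<^esub> single R \<one>\<^bsub>G\<^esub> (\<epsilon> f) \<in> M}"
      using D(2) by (simp add: a_minus_def)
    fix f h assume "f \<in> {f \<in> carrier RG. f \<ominus>\<^bsub>RG\<^esub> single R \<one>\<^bsub>G\<^esub> (\<epsilon> f) \<in> M}"
      "h \<in> {f \<in> carrier RG. f \<ominus>\<^bsub>RG\<^esub> single R \<one>\<^bsub>G\<^esub> (\<epsilon> f) \<in> M}"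
    hence f: "f \<in> carrier RG" "f \<ominus>\<^bsub>RG\<^esub> single R \<one>\<^bsub>G\<^esub> (\<epsilon> f) \<in> M"
      and h: "h \<in> carrier RG" "h \<ominus>\<^bsub>RG\<^esub> single R \<one>\<^bsub>G\<^esub> (\<epsilon> h) \<in> M" by auto
    have "(f \<oplus>\<^bsub>RG\<^esub> h) \<ominus>\<^bsub>RG\<^esub> single R \<one>\<^bsub>G\<^esub> (\<epsilon> (f \<oplus>\<^bsub>RG\<^esub> h)) =
      (f \<ominus>\<^bsub>RG\<^esub> single R \<one>\<^bsub>G\<^esub> (\<epsilon> f)) \<oplus>\<^bsub>RG\<^esub> (h \<ominus>\<^bsub>RG\<^esub> single R \<one>\<^bsub>G\<^esub> (\<epsilon> h))"
      using f(1) h(1) by (simp add: a_minus_def RG.minus_add RG.a_ac)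
    thus "f \<oplus>\<^bsub>RG\<^esub> h \<in> {f \<in> carrier RG. f \<ominus>\<^bsub>RG\<^esub> single R \<one>\<^bsub>G\<^esub> (\<epsilon> f) \<in> M}"
      using f h D(3) by simp
  next
    fix g r assume g: "g \<in> carrier G" and r: "r \<in> carrier R"
    have rC: "single R \<one>\<^bsub>G\<^esub> r \<in> carrier RG" using r by (simp add: single_closed)
    have "single R \<one>\<^bsub>G\<^esub> r \<otimes>\<^bsub>RG\<^esub> (\<delta> g \<ominus>\<^bsub>RG\<^esub> \<one>\<^bsub>RG\<^esub>) = single R g r \<ominus>\<^bsub>RG\<^esub> single R \<one>\<^bsub>G\<^esub> r"
      using rC \<delta>[OF g] const_mult_single[OF g r]
      by (simp add: a_minus_def RG.r_distr RG.r_minus \<delta>_def)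
    thus "single R g r \<in> {f \<in> carrier RG. f \<ominus>\<^bsub>RG\<^esub> single R \<one>\<^bsub>G\<^esub> (\<epsilon> f) \<in> M}"
      using D(6)[OF rC triv[OF g]] g r by (simp add: single_closed augmentation_single)
  qed
  hence "x \<ominus>\<^bsub>RG\<^esub> single R \<one>\<^bsub>G\<^esub> (\<epsilon> x) \<in> M" using x(1) by blast
  hence "x \<ominus>\<^bsub>RG\<^esub> \<one>\<^bsub>RG\<^esub> \<in> M" using x(2) by simp
  moreover have "x \<in> M" using I(3) M(2) by blast
  ultimately have "x \<ominus>\<^bsub>RG\<^esub> (x \<ominus>\<^bsub>RG\<^esub> \<one>\<^bsub>RG\<^esub>) \<in> M" using D(5) by blast
  moreover have "x \<ominus>\<^bsub>RG\<^esub> (x \<ominus>\<^bsub>RG\<^esub> \<one>\<^bsub>RG\<^esub>) = \<one>\<^bsub>RG\<^esub>"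
    using x(1) by (simp add: a_minus_def RG.minus_add RG.r_neg2)
  ultimately show False using RG.left_ideal_eq_carrier lM by simp
qed

text \<open>A left inverse \<open>y\<close> of \<open>x\<close> again has augmentation one and so
  has a left inverse \<open>z\<close>. Then z = z (y x) = x, and \<open>y\<close> is a two-sided
  inverse.\<close>

lemma Units_if_augmentation_one:
  assumes p: "Factorial_Ring.prime p" "p_group p G" "finite (carrier G)"
    and q: "[p] \<cdot>\<^bsub>R\<^esub> \<one>\<^bsub>R\<^esub> \<in> jacobson_radical R"
    and x: "x \<in> carrier RG" "\<epsilon> x = \<one>\<^bsub>R\<^esub>"
  shows "x \<in> Units RG"
proof -
  obtain y where y: "y \<in> carrier RG" "y \<otimes>\<^bsub>RG\<^esub> x = \<one>\<^bsub>RG\<^esub>"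
    using left_inverse_if_augmentation_one[OF assms] by blast
  have "\<epsilon> (y \<otimes>\<^bsub>RG\<^esub> x) = \<epsilon> y" using x y(1) by (simp add: augmentation_closed)
  hence "\<epsilon> y = \<one>\<^bsub>R\<^esub>" using y(2) by simp
  then obtain z where z: "z \<in> carrier RG" "z \<otimes>\<^bsub>RG\<^esub> y = \<one>\<^bsub>RG\<^esub>"
    using left_inverse_if_augmentation_one[OF p q y(1)] by blast
  have "z = z \<otimes>\<^bsub>RG\<^esub> (y \<otimes>\<^bsub>RG\<^esub> x)" using y(2) z(1) by simp
  also have "\<dots> = x" using x(1) y(1) z by (simp add: RG.m_assoc[symmetric])
  finally show ?thesis using x(1) y z(2) unfolding Units_def by blast
qed

end

section \<open>From finite subgroups to locally finite groups\<close>

lemma p_group_subgroup: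
  assumes "p_group p G" "subgroup H G"
  shows "p_group p (G\<lparr>carrier := H\<rparr>)"
proof -
  interpret G: group G using assms(1) by (simp add: p_group_def)
  interpret H: group "G\<lparr>carrier := H\<rparr>" using assms(2) G.subgroup_imp_group by blast
  \<comment> \<open>Powers agree in both groups, and the order is determined by which powers are
    trivial.\<close>
  have "H.ord x = G.ord x" if "x \<in> H" for x
  proof -
    have "x \<in> carrier G" using that subgroup.subset[OF assms(2)] by blast
    moreover have "x [^]\<^bsub>G\<lparr>carrier := H\<rparr>\<^esub> (n::nat) = x [^]\<^bsub>G\<^esub> n" for n
      using G.nat_pow_consistent[of x n H] by simp
    ultimately have "G.ord x dvd n \<longleftrightarrow> x [^]\<^bsub>G\<lparr>carrier := H\<rparr>\<^esub> n = \<one>\<^bsub>G\<lparr>carrier := H\<rparr>\<^esub>" for n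
      using G.pow_eq_id[of x n] by simp
    thus ?thesis using that by (subst H.ord_unique) auto
  qed
  moreover have "H \<subseteq> carrier G" using subgroup.subset[OF assms(2)] .
  ultimately show ?thesis
    using assms(1) H.group_axioms by (auto simp: p_group_def)
qed

text \<open>As functions are extended by zero, the group ring of \<open>H\<close> is literally a
  subset of RG with the same identity. Once the products are seen to agree, an inverse there is an
  inverse in RG.\<close>

lemma (in ring_and_group) Units_group_ring_subgroup:
  assumes H: "subgroup H G"
    and u: "u \<in> Units (group_ring R (G\<lparr>carrier := H\<rparr>))"
  shows "u \<in> Units RG"
proof -
  let ?RH = "group_ring R (G\<lparr>carrier := H\<rparr>)"
  interpret GH: group "G\<lparr>carrier := H\<rparr>" using H G.subgroup_imp_group by blast
  interpret RH: ring_and_group R "G\<lparr>carrier := H\<rparr>" ..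
  have HG: "H \<subseteq> carrier G" using subgroup.subset[OF H] .
  have sub: "f \<in> carrier RG" if "f \<in> carrier ?RH" for f
  proof -
    have "f x \<in> carrier R" for x using RH.apply_closed[OF that] .
    thus ?thesis using that HG by (auto simp: carrier_RG RH.carrier_RG)
  qed
  have mult: "f \<otimes>\<^bsub>?RH\<^esub> h = f \<otimes>\<^bsub>RG\<^esub> h" if f: "f \<in> carrier ?RH" and h: "h \<in> carrier ?RH" for f h
  proof
    fix x
    let ?F = "{y. f y \<noteq> \<zero>\<^bsub>R\<^esub>}"
    have F: "?F \<subseteq> H" using f by (auto simp: RH.carrier_RG)
    have inv: "inv\<^bsub>G\<lparr>carrier := H\<rparr>\<^esub> y = inv\<^bsub>G\<^esub> y" if "y \<in> ?F" for y
      using G.m_inv_consistent[OF H] that F by blast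
    consider "x \<in> H" | "x \<in> carrier G" "x \<notin> H" | "x \<notin> carrier G" by blast
    thus "(f \<otimes>\<^bsub>?RH\<^esub> h) x = (f \<otimes>\<^bsub>RG\<^esub> h) x"
    proof cases
      case 1
      have "(\<Oplus>\<^bsub>R\<^esub>y\<in>?F. f y \<otimes>\<^bsub>R\<^esub> h (inv\<^bsub>G\<lparr>carrier := H\<rparr>\<^esub> y \<otimes>\<^bsub>G\<^esub> x)) =
          (\<Oplus>\<^bsub>R\<^esub>y\<in>?F. f y \<otimes>\<^bsub>R\<^esub> h (inv\<^bsub>G\<^esub> y \<otimes>\<^bsub>G\<^esub> x))"
        by (rule R.finsum_cong') (use inv RH.apply_closed[OF f] RH.apply_closed[OF h] in auto)
      thus ?thesis using 1 HG by (auto simp: group_ring_def)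
    next
      case 2
      \<comment> \<open>Outside \<open>H\<close> the product over \<open>H\<close> is zero by
        definition. In RG each summand vanishes, because for y in \<open>H\<close> the second
        argument leaves \<open>H\<close> along with \<open>x\<close>.\<close>
      have "f y \<otimes>\<^bsub>R\<^esub> h (inv\<^bsub>G\<^esub> y \<otimes>\<^bsub>G\<^esub> x) = \<zero>\<^bsub>R\<^esub>" if y: "y \<in> ?F" for y
      proof -
        have yH: "y \<in> H" using y F by blast
        have "inv\<^bsub>G\<^esub> y \<otimes>\<^bsub>G\<^esub> x \<notin> H"
        proof
          assume "inv\<^bsub>G\<^esub> y \<otimes>\<^bsub>G\<^esub> x \<in> H"
          hence "y \<otimes>\<^bsub>G\<^esub> (inv\<^bsub>G\<^esub> y \<otimes>\<^bsub>G\<^esub> x) \<in> H" by (rule subgroup.m_closed[OF H yH])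
          moreover have "y \<otimes>\<^bsub>G\<^esub> (inv\<^bsub>G\<^esub> y \<otimes>\<^bsub>G\<^esub> x) = x"
            using yH HG 2(1) by (auto simp: G.m_assoc[symmetric])
          ultimately show False using 2(2) by simp
        qed
        thus ?thesis using h RH.apply_closed[OF f] by (simp add: RH.carrier_RG)
      qed
      hence "(\<Oplus>\<^bsub>R\<^esub>y\<in>?F. f y \<otimes>\<^bsub>R\<^esub> h (inv\<^bsub>G\<^esub> y \<otimes>\<^bsub>G\<^esub> x)) = (\<Oplus>\<^bsub>R\<^esub>y\<in>?F. \<zero>\<^bsub>R\<^esub>)"
        by (intro R.finsum_cong') auto
      thus ?thesis using 2 by (simp add: group_ring_def)
    next
      case 3
      thus ?thesis using HG by (auto simp: group_ring_def)
    qed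
  qed
  have one: "\<one>\<^bsub>?RH\<^esub> = \<one>\<^bsub>RG\<^esub>" by (simp add: group_ring_def)
  obtain v where v: "v \<in> carrier ?RH" "v \<otimes>\<^bsub>?RH\<^esub> u = \<one>\<^bsub>?RH\<^esub>" "u \<otimes>\<^bsub>?RH\<^esub> v = \<one>\<^bsub>?RH\<^esub>"
    using u unfolding Units_def by blast
  have uC: "u \<in> carrier ?RH" using u RH.RG.Units_closed by blast
  have "v \<otimes>\<^bsub>RG\<^esub> u = \<one>\<^bsub>RG\<^esub>" "u \<otimes>\<^bsub>RG\<^esub> v = \<one>\<^bsub>RG\<^esub>"
    using v one mult[OF v(1) uC] mult[OF uC v(1)] by simp_all
  thus ?thesis using sub uC v(1) unfolding Units_def by blast
qed

text \<open>Multiplying \<open>x\<close> by the constant inverse to its augmentation gives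
  \<open>y\<close> of augmentation one. The support of \<open>y\<close> generates a finite p-group,
  over which \<open>y\<close> is already known to be a unit.\<close>

lemma (in ring_and_group) augmentation_reflects_Units:
  assumes p: "Factorial_Ring.prime p" "p_group p G" and lf: "locally_finite_group G"
    and q: "[p] \<cdot>\<^bsub>R\<^esub> \<one>\<^bsub>R\<^esub> \<in> jacobson_radical R"
    and x: "x \<in> carrier RG" "\<epsilon> x \<in> Units R"
  shows "x \<in> Units RG"
proof -
  define r where "r = \<epsilon> x"
  have rU: "r \<in> Units R" using x(2) by (simp add: r_def)
  let ?s = "single R \<one>\<^bsub>G\<^esub> (inv\<^bsub>R\<^esub> r)"
  define y where "y = ?s \<otimes>\<^bsub>RG\<^esub> x"
  have sC: "?s \<in> carrier RG" using rU by (simp add: single_closed)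
  have yC: "y \<in> carrier RG" using sC x(1) by (simp add: y_def)
  have "\<epsilon> y = inv\<^bsub>R\<^esub> r \<otimes>\<^bsub>R\<^esub> r"
    using sC x(1) rU by (simp add: y_def augmentation_single r_def)
  hence y1: "\<epsilon> y = \<one>\<^bsub>R\<^esub>" using rU by simp
  define H where "H = generate G {g. y g \<noteq> \<zero>\<^bsub>R\<^esub>}"
  have supp: "{g. y g \<noteq> \<zero>\<^bsub>R\<^esub>} \<subseteq> carrier G" "finite {g. y g \<noteq> \<zero>\<^bsub>R\<^esub>}"
    using yC by (auto simp: carrier_RG)
  have H: "subgroup H G" unfolding H_def using supp(1) by (rule G.generate_is_subgroup)
  have finH: "finite H" using lf supp by (simp add: locally_finite_group_def H_def)
  have suppH: "y g = \<zero>\<^bsub>R\<^esub>" if "g \<notin> H" for g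
    using that by (auto simp: H_def intro: generate.incl)
  interpret GH: group "G\<lparr>carrier := H\<rparr>" using H G.subgroup_imp_group by blast
  interpret RH: ring_and_group R "G\<lparr>carrier := H\<rparr>" ..
  have "y \<in> carrier (group_ring R (G\<lparr>carrier := H\<rparr>))"
    using suppH supp(2) apply_closed[OF yC] by (simp add: RH.carrier_RG)
  hence "y \<in> Units (group_ring R (G\<lparr>carrier := H\<rparr>))"
    using RH.Units_if_augmentation_one[OF p(1) p_group_subgroup[OF p(2) H] _ q _ y1] finH by simp
  hence yU: "y \<in> Units RG" using H by (rule Units_group_ring_subgroup[rotated])
  let ?t = "single R \<one>\<^bsub>G\<^esub> r"
  have tU: "?t \<in> Units RG" using rU by (rule const.hom_Units)
  have "?t \<otimes>\<^bsub>RG\<^esub> y = (?t \<otimes>\<^bsub>RG\<^esub> ?s) \<otimes>\<^bsub>RG\<^esub> x"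
    using tU sC x(1) by (simp add: y_def RG.m_assoc RG.Units_closed)
  also have "?t \<otimes>\<^bsub>RG\<^esub> ?s = \<one>\<^bsub>RG\<^esub>"
    using rU by (simp add: const.hom_mult[symmetric] R.Units_closed del: const.hom_mult)
  finally have "x = ?t \<otimes>\<^bsub>RG\<^esub> y" using x(1) by simp
  thus ?thesis using tU yU RG.Units_m_closed by simp
qed

theorem proposition4p12:
  fixes R :: "('r, 'm) ring_scheme" and G :: "('g, 'n) monoid_scheme"
  assumes "ring R" and "group G"
  shows "(WDU (group_ring R G) \<longrightarrow> WDU R) \<and>
    (\<forall>p::nat. WDU R \<and> locally_finite_group G \<and> p_group p G \<and> Factorial_Ring.prime p \<and>
       [p] \<cdot>\<^bsub>R\<^esub> \<one>\<^bsub>R\<^esub> \<in> jacobson_radical R \<longrightarrow> WDU (group_ring R G))"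
proof -
  interpret ring_and_group R G
    using assms by (simp add: ring_and_group_def)
  have "WDU R" if "WDU RG"
    using WDU_retract[OF const.ring_hom_ring_axioms aug.ring_hom_ring_axioms _ that]
    by (simp add: augmentation_single)
  \<comment> \<open>Here the augmentation lifts the property from \<open>R\<close> to RG; above, it
    served as the retraction of the constants.\<close>
  moreover have "WDU RG" if "WDU R" "locally_finite_group G" "p_group p G"
    "Factorial_Ring.prime p" "[p] \<cdot>\<^bsub>R\<^esub> \<one>\<^bsub>R\<^esub> \<in> jacobson_radical R" for p
    using aug.WDU_reflect_Units[OF that(1)] augmentation_reflects_Units[OF that(4,3,2,5)] by blast
  ultimately show ?thesis by blast
qed

end
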